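(* The following hold (with $\log$ the natural logarithm, $n$ an integer, $c$ real, and $q\in(0,1)$ throughout): (i) If $n\ge 2$ and $0<c<\frac{1}{12\log(e^2 n)}$, then for every $q\le(1-c/n)^{n-1}$, the $c$-thinned $q$-quantile share is feasible for every profile of $n$ monotone valuations. (ii) If $n\ge 10^7+2$ and $0<c<\frac{1}{3e}$, then for every $q\le(1-c/n)^{n-1}$, the $c$-thinned $q$-quantile share is feasible for every profile of $n$ monotone valuations. (iii) Consequently, if $0<c<\frac{1}{12\log\left(e^2(10^7+1)\right)}$, then for every $q\le e^{-c}$ the $c$-thinned $q$-quantile share is universally feasible, i.e. feasible for every $n\ge 2$ and every profile of $n$ monotone valuations.
   Context: Let $[m]=\{1,\dots,m\}$ be a set of indivisible goods and $n\ge 2$ the number of agents. A monotone valuation on $[m]$ is a function $v:2^{[m]}\to\mathbb{R}_{\ge 0}$ with $v(\emptyset)=0$ and $v(A)\le v(B)$ whenever $A\subseteq B$. An allocation is an $n$-tuple $(S_1,\dots,S_n)$ of pairwise disjoint (possibly empty) subsets of $[m]$ whose union is $[m]$. For $c\in(0,1]$, the $c$-thinned random bundle $X^{(c)}\subseteq[m]$ is obtained by including each good independently with probability $c/n$. For $q\in(0,1)$, the $c$-thinned $q$-quantile share is $\tau_q^{(c)}(v,n):=\min\{t\in v(2^{[m]}):\mathbb{P}[v(X^{(c)})\le t]\ge q\}$. For a given $n$, this share is feasible for every profile of $n$ monotone valuations if for every finite set of goods $[m]$ and all monotone valuations $v_1,\dots,v_n$ on $[m]$ there is an allocation $(S_1,\dots,S_n)$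 with $v_i(S_i)\ge\tau_q^{(c)}(v_i,n)$ for all $i\in[n]$. *)

theory Defs
  imports "HOL-Probability.Probability"
begin

text \<open>
  Goods and agents are the initial segments \<open>{1..m}\<close> and \<open>{1..n}\<close> of the positive integers.
  A valuation is a total function on \<open>nat set\<close>; only its values on subsets of \<open>{1..m}\<close>
  are constrained or used.
\<close>

definition monotone_valuation :: "nat \<Rightarrow> (nat set \<Rightarrow> real) \<Rightarrow> bool" where
  "monotone_valuation m v \<longleftrightarrow>
     (\<forall>A. A \<subseteq> {1..m} \<longrightarrow> 0 \<le> v A) \<and>
     v {} = 0 \<and>
     (\<forall>A B. A \<subseteq> B \<longrightarrow> B \<subseteq> {1..m} \<longrightarrow> v A \<le> v B)"

definition allocation :: "nat \<Rightarrow> nat \<Rightarrow> (nat \<Rightarrow> nat set) \<Rightarrow> bool" where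
  "allocation m n S \<longleftrightarrow>
     disjoint_family_on S {1..n} \<and> (\<Union>i\<in>{1..n}. S i) = {1..m}"

definition thinned_bundle :: "nat \<Rightarrow> nat \<Rightarrow> real \<Rightarrow> nat set pmf" where
  "thinned_bundle m n c =
     map_pmf (\<lambda>f. {g \<in> {1..m}. f g})
       (Pi_pmf {1..m} False (\<lambda>_. bernoulli_pmf (c / real n)))"

text \<open>
  For \<open>q \<le> 1\<close> and a monotone valuation, the set below is finite and contains \<open>v {1..m}\<close>,
  so \<open>Min\<close> is a genuine minimum.
\<close>

definition quantile_share ::
    "nat \<Rightarrow> nat \<Rightarrow> real \<Rightarrow> real \<Rightarrow> (nat set \<Rightarrow> real) \<Rightarrow> real" where
  "quantile_share m n c q v =
     Min {t \<in> v ` Pow {1..m}. measure_pmf.prob (thinned_bundle m n c) {X. v X \<le> t} \<ge> q}"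

definition share_feasible :: "nat \<Rightarrow> real \<Rightarrow> real \<Rightarrow> bool" where
  "share_feasible n c q \<longleftrightarrow>
     (\<forall>m v. (\<forall>i\<in>{1..n}. monotone_valuation m (v i)) \<longrightarrow>
        (\<exists>S. allocation m n S \<and> (\<forall>i\<in>{1..n}. quantile_share m n c q (v i) \<le> v i (S i))))"

definition universally_feasible :: "real \<Rightarrow> real \<Rightarrow> bool" where
  "universally_feasible c q \<longleftrightarrow> (\<forall>n\<ge>2. share_feasible n c q)"

end

theory Submission
  imports Defs
begin

text \<open>
  Call a bundle acceptable for an agent if it is worth at least the agent's share. By the definition
  of the quantile and the bound on \<open>q\<close>, the acceptable bundles of each agent form an up-closed family
  of \<open>p\<close>-biased measure greater than \<open>1 - (1 - p) ^ (n - 1)\<close>, where \<open>p = c / n\<close>. An allocation as required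
  exists as soon as \<open>n\<close> such families have pairwise disjoint members, since left-over goods can be
  given to anybody. This is a biased, rainbow form of the Erdos matching problem, and the bound is
  sharp: the sets that meet \<open>n - 1\<close> fixed goods form a family of measure exactly
  \<open>1 - (1 - p) ^ (n - 1)\<close>, and \<open>n\<close> copies of it have no disjoint members. It is proved whenever
  \<open>p \<le> 1/48\<close> and \<open>e n p \<le> 1/3\<close>, and all three parts of the theorem are instances.

  Compression reduces to shifted families. For these, \<open>shifted_dominance\<close> says that a set
  \<open>S\<close> belongs to a family as soon as the family contains one set all of whose prefix counts are at
  most those of \<open>S\<close>. So if \<open>S\<close> is missing, then every member overtakes \<open>S\<close> somewhere, and for a
  set \<open>S\<close> that contains one good in every \<open>M\<close> consecutive ones with \<open>M p\<close> small this is a rare event, by a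
  union bound.
  In other words, a family of large measure contains many explicit sparse sets, and the
  disjoint members can be written down.

  Put \<open>s = n - 1\<close> and let \<open>\<epsilon>\<^sub>i\<close> be the measure of the part of the \<open>i\<close>-th family that avoids the goods
  \<open>1, \<dots>, s\<close>, with the families numbered from \<open>0\<close> to \<open>s\<close> such that \<open>\<epsilon>\<^sub>0 \<ge> \<dots> \<ge> \<epsilon>\<^sub>s\<close>. There are two
  ways to force a set into a family. If \<open>\<epsilon>\<^sub>i\<close> is large, then the family
  contains every set that is rarely overtaken by a random set beyond \<open>s\<close> (\<open>tail_measure_le_escape\<close>). If \<open>\<epsilon>\<^sub>i\<close> is small,
  then the family is close to the extremal one, so it contains the good \<open>s + 1 - i\<close> together with any
  fairly dense set beyond \<open>s\<close> (\<open>tail_measure_gt\<close>). Let \<open>k\<close> be the last index for which \<open>\<epsilon>\<^sub>k\<close> exceeds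
  roughly \<open>k p / 3\<close>. The families after \<open>k\<close> are of the second kind and are assigned the goods
  \<open>1, \<dots>, s - k\<close>; the others, which are of the first kind, are assigned the \<open>k + 1\<close> goods
  \<open>s - k + 1, \<dots>, s + 1\<close>. The goods after that are distributed by residue classes, with the modulus
  \<open>2 (k + 1)\<close> for the families up to \<open>k\<close> and \<open>2 n\<close> for the others, or \<open>n\<close> for all of them if
  \<open>2 (k + 1) > n\<close>.

  One case remains: if \<open>k = 0\<close>, then \<open>\<epsilon>\<^sub>0\<close> may be tiny. Here the first family also
  receives the goods \<open>s + 2, \<dots>, s + L\<close>, with the least \<open>L\<close> that puts the resulting set into it.
  Minimality of \<open>L\<close> bounds \<open>\<epsilon>\<^sub>0\<close>, and hence every \<open>\<epsilon>\<^sub>i\<close>, by about \<open>(2 p)\<^sup>L\<close>, so that the other families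
  are close enough to extremal to do without these goods.
\<close>

section \<open>The biased measure on subsets of a finite set\<close>

definition biased_weight :: "real \<Rightarrow> 'a set \<Rightarrow> 'a set \<Rightarrow> real" where
  "biased_weight p E A = p ^ card A * (1 - p) ^ card (E - A)"

definition biased_measure :: "real \<Rightarrow> 'a set \<Rightarrow> 'a set set \<Rightarrow> real" where
  "biased_measure p E F = (\<Sum>A\<in>Pow E \<inter> F. biased_weight p E A)"

lemma biased_weight_nonneg: "0 \<le> p \<Longrightarrow> p \<le> 1 \<Longrightarrow> 0 \<le> biased_weight p E A"
  by (simp add: biased_weight_def)

lemma biased_weight_Un:
  assumes "finite X" "finite Y" "X \<inter> Y = {}" "A \<subseteq> X" "B \<subseteq> Y"
  shows "biased_weight p (X \<union> Y) (A \<union> B) = biased_weight p X A * biased_weight p Y B"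
proof -
  have "card (A \<union> B) = card A + card B"
    using assms by (intro card_Un_disjoint) (auto intro: finite_subset)
  moreover have "card (X \<union> Y - (A \<union> B)) = card (X - A) + card (Y - B)"
  proof -
    have "X \<union> Y - (A \<union> B) = (X - A) \<union> (Y - B)" using assms by auto
    moreover have "(X - A) \<inter> (Y - B) = {}" using assms by auto
    ultimately show ?thesis using assms by (simp add: card_Un_disjoint)
  qed
  ultimately show ?thesis by (simp add: biased_weight_def power_add)
qed

lemma biased_measure_if:
  assumes "finite E"
  shows "biased_measure p E F = (\<Sum>A\<in>Pow E. if A \<in> F then biased_weight p E A else 0)"
  unfolding biased_measure_def using assms by (subst sum.inter_restrict) auto

lemma sum_Pow_Un:
  assumes "finite X" "finite Y" "X \<inter> Y = {}"
  shows "(\<Sum>A\<in>Pow (X \<union> Y). g A) = (\<Sum>A\<in>Pow X. \<Sum>B\<in>Pow Y. g (A \<union> B))"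
proof -
  have "(\<Sum>A\<in>Pow X. \<Sum>B\<in>Pow Y. g (A \<union> B)) = (\<Sum>(A, B)\<in>Pow X \<times> Pow Y. g (A \<union> B))"
    by (simp add: sum.cartesian_product)
  also have "\<dots> = (\<Sum>A\<in>Pow (X \<union> Y). g A)"
    by (rule sum.reindex_bij_witness
          [where i = "\<lambda>A. (A \<inter> X, A \<inter> Y)" and j = "\<lambda>(A, B). A \<union> B"])
       (use assms in \<open>auto simp: Int_Un_distrib2 inf.absorb1 simp flip: Int_Un_distrib\<close>)
  finally show ?thesis by simp
qed

text \<open>
  Independence of the parts of a random set in two disjoint ground sets.
\<close>

lemma biased_measure_Un:
  assumes "finite X" "finite Y" "X \<inter> Y = {}"
  shows "biased_measure p (X \<union> Y) F =
    (\<Sum>A\<in>Pow X. biased_weight p X A * biased_measure p Y {B. A \<union> B \<in> F})"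
proof -
  have "biased_measure p (X \<union> Y) F =
      (\<Sum>A\<in>Pow X. \<Sum>B\<in>Pow Y. if A \<union> B \<in> F then biased_weight p (X \<union> Y) (A \<union> B) else 0)"
    using assms by (simp add: biased_measure_if sum_Pow_Un)
  also have "\<dots> = (\<Sum>A\<in>Pow X. \<Sum>B\<in>Pow Y.
      biased_weight p X A * (if A \<union> B \<in> F then biased_weight p Y B else 0))"
    using assms by (intro sum.cong) (auto simp: biased_weight_Un)
  finally show ?thesis
    using assms by (simp add: biased_measure_if sum_distrib_left)
qed

lemma biased_measure_UNIV: "finite E \<Longrightarrow> biased_measure p E UNIV = 1"
proof (induction E rule: finite_induct)
  case empty
  show ?case by (simp add: biased_measure_def biased_weight_def)
next
  case (insert x E)
  have *: "Pow {x} = {{}, {x}}" by auto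
  have "biased_measure p ({x} \<union> E) UNIV = 1"
    using insert by (subst biased_measure_Un) (auto simp: * biased_weight_def)
  thus ?case by simp
qed

lemma biased_measure_nonneg: "0 \<le> p \<Longrightarrow> p \<le> 1 \<Longrightarrow> 0 \<le> biased_measure p E F"
  by (simp add: biased_measure_def sum_nonneg biased_weight_nonneg)

lemma biased_measure_mono:
  assumes "finite E" "0 \<le> p" "p \<le> 1" "\<And>A. A \<subseteq> E \<Longrightarrow> A \<in> F \<Longrightarrow> A \<in> G"
  shows "biased_measure p E F \<le> biased_measure p E G"
  unfolding biased_measure_def
  using assms by (intro sum_mono2) (auto simp: biased_weight_nonneg)

lemma biased_measure_cong:
  "(\<And>A. A \<subseteq> E \<Longrightarrow> A \<in> F \<longleftrightarrow> A \<in> G) \<Longrightarrow> biased_measure p E F = biased_measure p E G"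
  unfolding biased_measure_def by (intro sum.cong) auto

lemma biased_measure_Union:
  assumes "finite E" "0 \<le> p" "p \<le> 1" "finite I"
  shows "biased_measure p E (\<Union>i\<in>I. F i) \<le> (\<Sum>i\<in>I. biased_measure p E (F i))"
proof -
  have "biased_measure p E (\<Union>i\<in>I. F i) =
      (\<Sum>A\<in>Pow E. if A \<in> (\<Union>i\<in>I. F i) then biased_weight p E A else 0)"
    by (rule biased_measure_if) fact
  also have "\<dots> \<le> (\<Sum>A\<in>Pow E. \<Sum>i\<in>I. if A \<in> F i then biased_weight p E A else 0)"
  proof (rule sum_mono)
    fix A assume "A \<in> Pow E"
    show "(if A \<in> (\<Union>i\<in>I. F i) then biased_weight p E A else 0)
        \<le> (\<Sum>i\<in>I. if A \<in> F i then biased_weight p E A else 0)"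
    proof (cases "A \<in> (\<Union>i\<in>I. F i)")
      case True
      then obtain i where i: "i \<in> I" "A \<in> F i" by auto
      have "(if A \<in> F i then biased_weight p E A else 0)
        \<le> (\<Sum>i\<in>I. if A \<in> F i then biased_weight p E A else 0)"
        using assms i by (intro member_le_sum) (auto simp: biased_weight_nonneg)
      thus ?thesis using i by auto
    qed (auto intro!: sum_nonneg simp: biased_weight_nonneg assms)
  qed
  also have "\<dots> = (\<Sum>i\<in>I. biased_measure p E (F i))"
    using assms by (subst sum.swap) (simp add: biased_measure_if)
  finally show ?thesis .
qed

lemma biased_measure_Compl:
  assumes "finite E"
  shows "biased_measure p E (- F) = 1 - biased_measure p E F"
proof -
  have "biased_measure p E F + biased_measure p E (- F) = biased_measure p E UNIV"
    using assms unfolding biased_measure_if[OF assms] sum.distrib[symmetric]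
    by (intro sum.cong) auto
  thus ?thesis using assms by (simp add: biased_measure_UNIV)
qed

lemma biased_measure_le_1:
  assumes "finite E" "0 \<le> p" "p \<le> 1"
  shows "biased_measure p E F \<le> 1"
  using biased_measure_mono[of E p F UNIV] biased_measure_UNIV[of E p] assms by auto

lemma biased_measure_superset:
  assumes "finite E" "B \<subseteq> E"
  shows "biased_measure p E {A. B \<subseteq> A} = p ^ card B"
proof -
  have fin: "finite B" "finite (E - B)" using assms by (auto intro: finite_subset)
  have E: "E = B \<union> (E - B)" using assms by auto
  have "biased_measure p E {A. B \<subseteq> A} =
      (\<Sum>X\<in>Pow B. biased_weight p B X * biased_measure p (E - B) {C. B \<subseteq> X \<union> C})"
    by (subst E, subst biased_measure_Un) (use fin in auto)
  also have "\<dots> = (\<Sum>X\<in>Pow B. if X = B then p ^ card B else 0)"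
  proof (rule sum.cong)
    fix X assume X: "X \<in> Pow B"
    show "biased_weight p B X * biased_measure p (E - B) {C. B \<subseteq> X \<union> C}
        = (if X = B then p ^ card B else 0)"
    proof (cases "X = B")
      case True
      thus ?thesis using fin by (simp add: biased_weight_def biased_measure_UNIV)
    next
      case False
      have "biased_measure p (E - B) {C. B \<subseteq> X \<union> C} = biased_measure p (E - B) {}"
        using X False by (intro biased_measure_cong) auto
      thus ?thesis using False by (simp add: biased_measure_def)
    qed
  qed simp
  finally show ?thesis using fin by simp
qed

text \<open>
  Union bound over the \<open>j\<close>-subsets of \<open>S\<close>, each of which is included with probability \<open>p ^ j\<close>.
\<close>

lemma biased_measure_card_ge:
  fixes p :: real
  assumes "finite E" "0 \<le> p" "p \<le> 1" "S \<subseteq> E"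
  shows "biased_measure p E {A. j \<le> card (A \<inter> S)} \<le> real (card S choose j) * p ^ j"
proof -
  have S: "finite S" using assms finite_subset by blast
  let ?I = "{B. B \<subseteq> S \<and> card B = j}"
  have "biased_measure p E {A. j \<le> card (A \<inter> S)} \<le> biased_measure p E (\<Union>B\<in>?I. {A. B \<subseteq> A})"
  proof (rule biased_measure_mono)
    fix A assume "A \<subseteq> E" "A \<in> {A. j \<le> card (A \<inter> S)}"
    then obtain B where "B \<subseteq> A \<inter> S" "card B = j"
      by (auto elim!: obtain_subset_with_card_n)
    thus "A \<in> (\<Union>B\<in>?I. {A. B \<subseteq> A})" by auto
  qed (use assms in auto)
  also have "\<dots> \<le> (\<Sum>B\<in>?I. biased_measure p E {A. B \<subseteq> A})"
    using assms S by (intro biased_measure_Union) auto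
  also have "\<dots> = (\<Sum>B\<in>?I. p ^ j)"
    using assms by (intro sum.cong) (auto simp: biased_measure_superset)
  also have "\<dots> = real (card S choose j) * p ^ j"
    using S by (simp add: n_subsets)
  finally show ?thesis .
qed

lemma biased_measure_avoid:
  assumes "finite E" "0 \<le> p" "p \<le> 1" "S \<subseteq> E"
  shows "biased_measure p E {A. A \<inter> S = {} \<and> A \<in> F} = (1 - p) ^ card S * biased_measure p (E - S) F"
proof -
  have fin: "finite S" "finite (E - S)" using assms by (auto intro: finite_subset)
  have E: "E = S \<union> (E - S)" using assms by auto
  have "biased_measure p E {A. A \<inter> S = {} \<and> A \<in> F} =
      (\<Sum>X\<in>Pow S. biased_weight p S X * biased_measure p (E - S) {B. (X \<union> B) \<inter> S = {} \<and> X \<union> B \<in> F})"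
    by (subst E, subst biased_measure_Un) (use fin in auto)
  also have "\<dots> = (\<Sum>X\<in>Pow S. if X = {} then (1 - p) ^ card S * biased_measure p (E - S) F else 0)"
  proof (rule sum.cong)
    fix X assume X: "X \<in> Pow S"
    show "biased_weight p S X * biased_measure p (E - S) {B. (X \<union> B) \<inter> S = {} \<and> X \<union> B \<in> F}
        = (if X = {} then (1 - p) ^ card S * biased_measure p (E - S) F else 0)"
    proof (cases "X = {}")
      case True
      have "biased_measure p (E - S) {B. (X \<union> B) \<inter> S = {} \<and> X \<union> B \<in> F} = biased_measure p (E - S) F"
        using True by (intro biased_measure_cong) auto
      thus ?thesis using True by (simp add: biased_weight_def)
    next
      case False
      have "biased_measure p (E - S) {B. (X \<union> B) \<inter> S = {} \<and> X \<union> B \<in> F} = biased_measure p (E - S) {}"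
        using X False by (intro biased_measure_cong) auto
      thus ?thesis using False by (simp add: biased_measure_def)
    qed
  qed simp
  finally show ?thesis using fin by simp
qed

text \<open>
  The finite sum makes the thinned bundle accessible to combinatorial arguments on families of sets.
\<close>

lemma prob_thinned_bundle:
  assumes "0 \<le> c" "c \<le> real n"
  shows "measure_pmf.prob (thinned_bundle m n c) F = biased_measure (c / real n) {1..m} F"
proof -
  let ?E = "{1..m}" and ?p = "c / real n"
  let ?M = "Pi_pmf ?E False (\<lambda>_. bernoulli_pmf ?p)"
  let ?h = "\<lambda>f. {g \<in> ?E. f g}"
  have p: "0 \<le> ?p" "?p \<le> 1" using assms by (auto simp: divide_le_eq_1)
  have out: "f x = False" if "f \<in> set_pmf ?M" "x \<notin> ?E" for f x
    using set_Pi_pmf_subset[of ?E False] that by blast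
  have supp: "set_pmf (thinned_bundle m n c) \<subseteq> Pow ?E"
    unfolding thinned_bundle_def by auto
  have pmf_eq: "pmf (thinned_bundle m n c) A = biased_weight ?p ?E A" if A: "A \<in> Pow ?E" for A
  proof -
    have "pmf (thinned_bundle m n c) A = measure_pmf.prob ?M (?h -` {A})"
      unfolding thinned_bundle_def by (rule pmf_map)
    also have "\<dots> = measure_pmf.prob ?M {\<lambda>x. x \<in> A}"
    proof (rule measure_eq_AE)
      show "AE f in measure_pmf ?M. (f \<in> ?h -` {A}) = (f \<in> {\<lambda>x. x \<in> A})"
      proof (rule AE_pmfI)
        fix f assume f: "f \<in> set_pmf ?M"
        show "(f \<in> ?h -` {A}) = (f \<in> {\<lambda>x. x \<in> A})"
          using out[OF f] A by (auto simp: fun_eq_iff)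
      qed
    qed auto
    also have "\<dots> = pmf ?M (\<lambda>x. x \<in> A)" by (simp add: pmf.rep_eq)
    also have "\<dots> = (\<Prod>x\<in>?E. pmf (bernoulli_pmf ?p) (x \<in> A))"
      using A by (subst pmf_Pi) auto
    also have "\<dots> = (\<Prod>x\<in>?E. if x \<in> A then ?p else 1 - ?p)"
      using p by (intro prod.cong) auto
    also have "\<dots> = biased_weight ?p ?E A"
      using A by (subst prod.If_cases) (auto simp: biased_weight_def inf.absorb2 Diff_eq)
    finally show ?thesis .
  qed
  have "measure_pmf.prob (thinned_bundle m n c) F
      = measure_pmf.prob (thinned_bundle m n c) (Pow ?E \<inter> F)"
    using supp by (intro measure_eq_AE AE_pmfI) auto
  also have "\<dots> = (\<Sum>A\<in>Pow ?E \<inter> F. pmf (thinned_bundle m n c) A)"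
    by (intro measure_measure_pmf_finite) auto
  also have "\<dots> = biased_measure ?p ?E F"
    unfolding biased_measure_def by (intro sum.cong) (auto simp: pmf_eq)
  finally show ?thesis .
qed


section \<open>Compression and shifted families\<close>

definition exchange :: "nat \<Rightarrow> nat \<Rightarrow> nat set \<Rightarrow> nat set" where
  "exchange i j A = insert i (A - {j})"

text \<open>
  The members of \<open>F\<close> for which the exchange of \<open>j\<close> by \<open>i\<close> produces a new set; compression replaces
  exactly these, so that it does not change the number of sets.
\<close>

definition movable :: "nat \<Rightarrow> nat \<Rightarrow> nat set set \<Rightarrow> nat set set" where
  "movable i j F = {A \<in> F. j \<in> A \<and> i \<notin> A \<and> exchange i j A \<notin> F}"

definition compress :: "nat \<Rightarrow> nat \<Rightarrow> nat set set \<Rightarrow> nat set set" where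
  "compress i j F = (F - movable i j F) \<union> exchange i j ` movable i j F"

definition shifted :: "nat \<Rightarrow> nat set set \<Rightarrow> bool" where
  "shifted m F \<longleftrightarrow>
     (\<forall>i\<in>{1..m}. \<forall>j\<in>{1..m}. \<forall>A\<in>F. i < j \<longrightarrow> j \<in> A \<longrightarrow> i \<notin> A \<longrightarrow> exchange i j A \<in> F)"

definition upclosed :: "'a set \<Rightarrow> 'a set set \<Rightarrow> bool" where
  "upclosed E F \<longleftrightarrow> F \<subseteq> Pow E \<and> (\<forall>A\<in>F. \<forall>B. A \<subseteq> B \<longrightarrow> B \<subseteq> E \<longrightarrow> B \<in> F)"

text \<open>
  The negation is what is called cross-dependence of the families.
\<close>

definition rainbow :: "'i set \<Rightarrow> ('i \<Rightarrow> 'a set set) \<Rightarrow> bool" where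
  "rainbow I F \<longleftrightarrow> (\<exists>B. disjoint_family_on B I \<and> (\<forall>i\<in>I. B i \<in> F i))"

lemma inj_on_exchange: "inj_on (exchange i j) (movable i j F)"
proof (rule inj_onI)
  fix A B assume *: "A \<in> movable i j F" "B \<in> movable i j F" "exchange i j A = exchange i j B"
  have "insert j (exchange i j A - {i}) = A" "insert j (exchange i j B - {i}) = B"
    using * by (auto simp: movable_def exchange_def)
  with * show "A = B" by metis
qed

text \<open>
  Used with the biased weight, where every difference vanishes, and with the sum of the elements,
  where every difference is negative if \<open>i < j\<close>.
\<close>

lemma sum_compress:
  fixes g :: "nat set \<Rightarrow> 'b :: ab_group_add"
  assumes "finite F"
  shows "sum g (compress i j F) = sum g F + (\<Sum>A\<in>movable i j F. g (exchange i j A) - g A)"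
proof -
  have sub: "movable i j F \<subseteq> F" by (auto simp: movable_def)
  have "sum g (compress i j F) = sum g (F - movable i j F) + sum g (exchange i j ` movable i j F)"
    unfolding compress_def
    using assms sub by (intro sum.union_disjoint) (auto simp: movable_def intro: finite_subset)
  thus ?thesis
    using assms sub by (simp add: sum.reindex[OF inj_on_exchange] sum_diff sum_subtractf)
qed

lemma compress_subset:
  assumes "F \<subseteq> Pow E" "i \<in> E" shows "compress i j F \<subseteq> Pow E"
  using assms by (auto simp: compress_def movable_def exchange_def)

lemma card_exchange:
  assumes "finite A" "j \<in> A" "i \<notin> A" shows "card (exchange i j A) = card A"
proof -
  have "0 < card A" using assms card_gt_0_iff by blast
  thus ?thesis using assms by (simp add: exchange_def card_insert_if)
qed

lemma biased_measure_compress: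
  assumes "finite E" "F \<subseteq> Pow E" "i \<in> E" "j \<in> E"
  shows "biased_measure p E (compress i j F) = biased_measure p E F"
proof -
  have fin: "finite F" using assms by (meson finite_Pow_iff finite_subset)
  have w: "biased_weight p E (exchange i j A) = biased_weight p E A" if "A \<in> movable i j F" for A
  proof -
    have A: "A \<subseteq> E" "j \<in> A" "i \<notin> A" using that assms by (auto simp: movable_def)
    have sub: "exchange i j A \<subseteq> E" using A assms by (auto simp: exchange_def)
    have "card (exchange i j A) = card A"
      using A assms by (intro card_exchange) (auto intro: finite_subset)
    moreover from this have "card (E - exchange i j A) = card (E - A)"
      using A sub assms by (simp add: card_Diff_subset finite_subset[OF _ \<open>finite E\<close>])
    ultimately show ?thesis by (simp add: biased_weight_def)
  qed
  have "biased_measure p E (compress i j F) = sum (biased_weight p E) (compress i j F)"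
    using compress_subset[OF assms(2,3)] by (simp add: biased_measure_def inf.absorb2)
  also have "\<dots> = sum (biased_weight p E) F"
    using fin by (simp add: sum_compress w)
  finally show ?thesis using assms by (simp add: biased_measure_def inf.absorb2)
qed

text \<open>
  On the sets with a given trace outside \<open>{i, j}\<close>, compression replaces the membership bits of the
  two one-sided sets by their conjunction and disjunction, which preserves monotonicity.
\<close>

lemma mem_compress_iff:
  assumes "i \<noteq> j"
  shows "A \<in> compress i j F \<longleftrightarrow>
    (if i \<in> A \<and> j \<notin> A then A \<in> F \<or> exchange j i A \<in> F
     else if j \<in> A \<and> i \<notin> A then A \<in> F \<and> exchange i j A \<in> F
     else A \<in> F)"
proof -
  have inv: "exchange j i (exchange i j A) = A" if "j \<in> A" "i \<notin> A" for A
    using that by (auto simp: exchange_def)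
  have inv': "exchange i j (exchange j i A) = A" if "i \<in> A" "j \<notin> A" for A
    using that by (auto simp: exchange_def)
  have *: "A \<in> exchange i j ` movable i j F \<longleftrightarrow> i \<in> A \<and> j \<notin> A \<and> A \<notin> F \<and> exchange j i A \<in> F"
  proof
    assume "A \<in> exchange i j ` movable i j F"
    then obtain B where "B \<in> F" "j \<in> B" "i \<notin> B" "exchange i j B \<notin> F" "A = exchange i j B"
      by (auto simp: movable_def)
    thus "i \<in> A \<and> j \<notin> A \<and> A \<notin> F \<and> exchange j i A \<in> F"
      using assms inv by (auto simp: exchange_def)
  next
    assume A: "i \<in> A \<and> j \<notin> A \<and> A \<notin> F \<and> exchange j i A \<in> F"
    moreover have "j \<in> exchange j i A" "i \<notin> exchange j i A"
      using assms by (auto simp: exchange_def)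
    ultimately have "exchange j i A \<in> movable i j F"
      using inv'[of A] by (simp add: movable_def)
    thus "A \<in> exchange i j ` movable i j F" using A inv'[of A] by (metis imageI)
  qed
  show ?thesis unfolding compress_def Un_iff * by (auto simp: movable_def)
qed

lemma upclosedD: "upclosed E F \<Longrightarrow> A \<in> F \<Longrightarrow> A \<subseteq> B \<Longrightarrow> B \<subseteq> E \<Longrightarrow> B \<in> F"
  by (auto simp: upclosed_def)

lemma upclosed_compress:
  assumes "upclosed E F" "i \<in> E" "j \<in> E" "i \<noteq> j"
  shows "upclosed E (compress i j F)"
proof -
  have sub: "F \<subseteq> Pow E" using assms by (auto simp: upclosed_def)
  have "B \<in> compress i j F" if A: "A \<in> compress i j F" and AB: "A \<subseteq> B" "B \<subseteq> E" for A B
  proof -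
    have B: "B \<in> F" if "A \<in> F" using upclosedD[OF assms(1) that AB] .
    have ex1: "exchange i j B \<in> F" if "C \<in> F" "C \<subseteq> exchange i j B" for C
      using upclosedD[OF assms(1) that] AB assms by (auto simp: exchange_def)
    have ex2: "exchange j i B \<in> F" if "C \<in> F" "C \<subseteq> exchange j i B" for C
      using upclosedD[OF assms(1) that] AB assms by (auto simp: exchange_def)
    have up: "B \<in> F" if "C \<in> F" "C \<subseteq> B" for C
      using upclosedD[OF assms(1) that AB(2)] .
    consider "i \<in> A" "j \<in> A" | "i \<in> A" "j \<notin> A" | "i \<notin> A" "j \<in> A" | "i \<notin> A" "j \<notin> A" by blast
    thus ?thesis
    proof cases
      case 1
      thus ?thesis using A B AB by (auto simp: mem_compress_iff[OF assms(4)])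
    next
      case 2
      hence "A \<in> F \<or> exchange j i A \<in> F" using A by (simp add: mem_compress_iff[OF assms(4)])
      thus ?thesis
      proof
        assume "exchange j i A \<in> F"
        moreover have "exchange j i A \<subseteq> (if j \<in> B then B else exchange j i B)"
          using AB 2 by (auto simp: exchange_def)
        ultimately show ?thesis
          using up[of "exchange j i A"] ex2[of "exchange j i A"] 2 AB
          by (auto simp: mem_compress_iff[OF assms(4)] split: if_splits)
      qed (use B 2 AB in \<open>auto simp: mem_compress_iff[OF assms(4)]\<close>)
    next
      case 3
      hence "A \<in> F" "exchange i j A \<in> F" using A by (auto simp: mem_compress_iff[OF assms(4)] split: if_splits)
      moreover have "exchange i j A \<subseteq> exchange i j B" using AB by (auto simp: exchange_def)
      ultimately show ?thesis
        using B ex1[of "exchange i j A"] 3 AB by (auto simp: mem_compress_iff[OF assms(4)])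
    next
      case 4
      hence "A \<in> F" using A by (simp add: mem_compress_iff[OF assms(4)])
      moreover have "A \<subseteq> exchange i j B" using AB 4 by (auto simp: exchange_def)
      ultimately show ?thesis
        using B ex1[of A] by (auto simp: mem_compress_iff[OF assms(4)])
    qed
  qed
  thus ?thesis using compress_subset[OF sub assms(2)] by (auto simp: upclosed_def)
qed

text \<open>
  At most one of the disjoint sets can fail to lie in its original family, namely the set that
  contains \<open>i\<close>. If it fails, then interchanging \<open>i\<close> and \<open>j\<close> in all the sets repairs it and keeps the
  others: the set with \<open>j\<close> but not \<open>i\<close>, if there is one, lies in a compressed family only if it and
  its exchanged version both lie in the original one.
\<close>

lemma rainbow_compressD:
  assumes "i \<noteq> j" "rainbow I (\<lambda>t. compress i j (F t))"
  shows "rainbow I F"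
proof -
  obtain B where B: "disjoint_family_on B I" "\<And>t. t \<in> I \<Longrightarrow> B t \<in> compress i j (F t)"
    using assms by (auto simp: rainbow_def)
  show ?thesis
  proof (cases "\<forall>t\<in>I. B t \<in> F t")
    case True
    thus ?thesis using B by (auto simp: rainbow_def)
  next
    case False
    then obtain a where a: "a \<in> I" "B a \<notin> F a" by blast
    have ia: "i \<in> B a" "j \<notin> B a" "exchange j i (B a) \<in> F a"
      using B(2)[OF a(1)] a(2) by (auto simp: mem_compress_iff[OF assms(1)] split: if_splits)
    have disj: "B t \<inter> B u = {}" if "t \<in> I" "u \<in> I" "t \<noteq> u" for t u
      using B(1) that by (auto simp: disjoint_family_on_def)
    define C where "C = (\<lambda>t. if t = a then exchange j i (B t)
                             else if j \<in> B t then exchange i j (B t) else B t)"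
    have "C t \<in> F t" if t: "t \<in> I" for t
    proof (cases "t = a")
      case False
      hence "i \<notin> B t" using disj[OF t a(1)] ia by auto
      thus ?thesis
        using B(2)[OF t] False by (auto simp: C_def mem_compress_iff[OF assms(1)] split: if_splits)
    qed (use ia in \<open>auto simp: C_def\<close>)
    moreover have "disjoint_family_on C I"
      unfolding disjoint_family_on_def
    proof (intro ballI impI)
      fix t u assume tu: "t \<in> I" "u \<in> I" "t \<noteq> u"
      have "i \<notin> B t" if "t \<noteq> a" using disj[OF tu(1) a(1) that] ia by auto
      moreover have "i \<notin> B u" if "u \<noteq> a" using disj[OF tu(2) a(1) that] ia by auto
      ultimately show "C t \<inter> C u = {}"
        using disj[OF tu] ia tu(3) unfolding C_def exchange_def by (auto split: if_splits)
    qed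
    ultimately show ?thesis by (auto simp: rainbow_def)
  qed
qed

lemma sum_exchange_less:
  fixes A :: "nat set"
  assumes "finite A" "j \<in> A" "i \<notin> A" "i < j"
  shows "\<Sum>(exchange i j A) < \<Sum>A"
proof -
  have "\<Sum>(exchange i j A) = i + \<Sum>(A - {j})" using assms by (simp add: exchange_def)
  also have "\<dots> < j + \<Sum>(A - {j})" using assms by simp
  also have "\<dots> = \<Sum>A" using assms by (simp add: sum.remove)
  finally show ?thesis .
qed

text \<open>
  Compressing all families with the same pair of goods keeps every hypothesis. If the pair is one at
  which some family fails to be shifted, it lowers the total of all elements of all members.
\<close>

lemma rainbow_if_shifted_rainbow:
  fixes F :: "'i \<Rightarrow> nat set set"
  assumes fin: "finite I"
    and F: "\<And>t. t \<in> I \<Longrightarrow> upclosed {1..m} (F t) \<and> biased_measure p {1..m} (F t) > z"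
    and shifted_case: "\<And>G. (\<And>t. t \<in> I \<Longrightarrow> upclosed {1..m} (G t) \<and> shifted m (G t) \<and>
                           biased_measure p {1..m} (G t) > z) \<Longrightarrow> rainbow I G"
  shows "rainbow I F"
  using F
proof (induction "\<Sum>t\<in>I. \<Sum>A\<in>F t. \<Sum>A" arbitrary: F rule: less_induct)
  case less
  show ?case
  proof (cases "\<forall>t\<in>I. shifted m (F t)")
    case True
    thus ?thesis using shifted_case less.prems by blast
  next
    case False
    then obtain a i j A where a: "a \<in> I" and ij: "i \<in> {1..m}" "j \<in> {1..m}" "i < j"
      and A: "A \<in> F a" "j \<in> A" "i \<notin> A" "exchange i j A \<notin> F a"
      unfolding shifted_def by blast
    have sub: "F t \<subseteq> Pow {1..m}" if "t \<in> I" for t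
      using less.prems[OF that] by (auto simp: upclosed_def)
    hence finF: "finite (F t)" if "t \<in> I" for t
      using that finite_subset by (metis finite_Pow_iff finite_atLeastAtMost)
    have finA: "finite B" if "B \<in> F t" "t \<in> I" for B t
      using that sub[of t] finite_subset[of B "{1..m}"] by auto
    define D where "D = (\<lambda>t. \<Sum>B\<in>movable i j (F t). int (\<Sum>(exchange i j B)) - int (\<Sum>B))"
    have neg: "int (\<Sum>(exchange i j B)) - int (\<Sum>B) < 0"
      if "B \<in> movable i j (F t)" "t \<in> I" for B t
    proof -
      have "\<Sum>(exchange i j B) < \<Sum>B"
        using sum_exchange_less[of B j i] that finA ij(3) by (auto simp: movable_def)
      thus ?thesis by linarith
    qed
    have D_le: "D t \<le> 0" if "t \<in> I" for t
      unfolding D_def using neg that by (intro sum_nonpos) (auto intro: less_imp_le)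
    have D_less: "D a < 0"
    proof -
      have "A \<in> movable i j (F a)" using A by (auto simp: movable_def)
      moreover have "finite (movable i j (F a))" using finF[OF a] by (simp add: movable_def)
      ultimately have "0 < (\<Sum>B\<in>movable i j (F a). - (int (\<Sum>(exchange i j B)) - int (\<Sum>B)))"
        using neg[OF _ a]
        by (intro sum_pos2[of _ A]) (simp_all del: int_sum of_nat_sum add: less_imp_le)
      thus ?thesis unfolding D_def sum_negf by linarith
    qed
    have "int (\<Sum>t\<in>I. \<Sum>A\<in>compress i j (F t). \<Sum>A) = (\<Sum>t\<in>I. \<Sum>A\<in>compress i j (F t). int (\<Sum>A))"
      by (simp add: int_sum)
    also have "\<dots> = (\<Sum>t\<in>I. (\<Sum>A\<in>F t. int (\<Sum>A)) + D t)"
      unfolding D_def using finF by (intro sum.cong refl sum_compress)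
    also have "\<dots> = int (\<Sum>t\<in>I. \<Sum>A\<in>F t. \<Sum>A) + sum D I"
      by (simp add: int_sum sum.distrib)
    also have "\<dots> < int (\<Sum>t\<in>I. \<Sum>A\<in>F t. \<Sum>A)"
    proof -
      have "sum D I < (\<Sum>t\<in>I. 0)"
        using fin a D_le D_less by (intro sum_strict_mono_ex1) auto
      thus ?thesis by simp
    qed
    finally have dec: "(\<Sum>t\<in>I. \<Sum>A\<in>compress i j (F t). \<Sum>A) < (\<Sum>t\<in>I. \<Sum>A\<in>F t. \<Sum>A)"
      by (simp only: of_nat_less_iff)
    have "rainbow I (\<lambda>t. compress i j (F t))"
    proof (rule less.hyps[OF dec])
      fix t assume t: "t \<in> I"
      show "upclosed {1..m} (compress i j (F t)) \<and> z < biased_measure p {1..m} (compress i j (F t))"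
        using less.prems[OF t] upclosed_compress[of "{1..m}" "F t" i j]
          biased_measure_compress[of "{1..m}" "F t" i j p] sub[OF t] ij by simp
    qed
    thus ?thesis using ij rainbow_compressD[of i j I F] by simp
  qed
qed

text \<open>
  The sets above \<open>A\<close> in the order generated by enlarging a set and by replacing an element by a
  smaller one are those whose prefix counts are at least the ones of \<open>A\<close>. The first element \<open>a\<close> of
  \<open>A - T\<close> can be replaced by some smaller \<open>b \<in> T - A\<close>, because \<open>T\<close> has at least as many elements
  up to \<open>a\<close>; the prefix counts between \<open>b\<close> and \<open>a\<close>, which go up, stay below those of \<open>T\<close> since all
  elements of \<open>A\<close> before \<open>a\<close> lie in \<open>T\<close>.
\<close>

lemma shifted_dominance:
  assumes F: "shifted m F" "upclosed {1..m} F"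
    and T: "T \<subseteq> {1..m}" and AF: "A \<in> F"
    and le: "\<And>x. card (A \<inter> {1..x}) \<le> card (T \<inter> {1..x})"
  shows "T \<in> F"
  using AF le
proof (induction "card (A - T)" arbitrary: A rule: less_induct)
  case less
  have A: "A \<subseteq> {1..m}" using less.prems(1) F by (auto simp: upclosed_def)
  hence finA: "finite A" using finite_subset by blast
  show ?case
  proof (cases "A \<subseteq> T")
    case True
    thus ?thesis using upclosedD[OF F(2) less.prems(1)] T by blast
  next
    case False
    define a where "a = Min (A - T)"
    have a: "a \<in> A" "a \<notin> T" using Min_in[of "A - T"] False finA by (auto simp: a_def)
    have below: "x \<in> T" if "x \<in> A" "x < a" for x
    proof (rule ccontr)
      assume "x \<notin> T"
      hence "a \<le> x" unfolding a_def using that finA by (intro Min_le) auto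
      thus False using that by simp
    qed
    have "\<exists>b. b \<in> T \<and> b \<in> {1..a} \<and> b \<notin> A"
    proof (rule ccontr)
      assume "\<not> ?thesis"
      hence "T \<inter> {1..a} \<subset> A \<inter> {1..a}" using a A by fastforce
      hence "card (T \<inter> {1..a}) < card (A \<inter> {1..a})" by (intro psubset_card_mono) auto
      thus False using less.prems(2)[of a] by simp
    qed
    then obtain b where b: "b \<in> T" "1 \<le> b" "b \<le> a" "b \<notin> A" by auto
    have ba: "b < a" using b a by (cases "a = b") auto
    have ex: "exchange b a A \<in> F"
      using F(1) less.prems(1) a b ba A unfolding shifted_def by (meson atLeastAtMost_iff le_trans subsetD less_imp_le)
    have lt: "card (exchange b a A - T) < card (A - T)"
    proof (rule psubset_card_mono)
      show "exchange b a A - T \<subset> A - T" using a b by (auto simp: exchange_def)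
    qed (use finA in auto)
    have "card (exchange b a A \<inter> {1..x}) \<le> card (T \<inter> {1..x})" for x
    proof (cases "b \<le> x \<and> x < a")
      case True
      have "exchange b a A \<inter> {1..x} \<subseteq> T \<inter> {1..x}"
        using True below b by (auto simp: exchange_def)
      thus ?thesis by (intro card_mono) auto
    next
      case False
      have "card (exchange b a A \<inter> {1..x}) = card (A \<inter> {1..x})"
      proof (cases "x < b")
        case True
        hence "exchange b a A \<inter> {1..x} = A \<inter> {1..x}" using ba by (auto simp: exchange_def)
        thus ?thesis by simp
      next
        case nb: False
        hence x: "a \<le> x" using False by auto
        have "exchange b a A \<inter> {1..x} = exchange b a (A \<inter> {1..x})"
          using x b by (auto simp: exchange_def)
        thus ?thesis using a b x A by (auto intro!: card_exchange)
      qed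
      thus ?thesis using less.prems(2)[of x] by simp
    qed
    thus ?thesis using less.hyps[OF lt ex] by blast
  qed
qed


section \<open>Random sets crossing a barrier\<close>

text \<open>
  The barrier \<open>min (x - b) L + (x - b - L) div M\<close> counts the elements up to \<open>x\<close> of a set that contains
  \<open>b + 1, \<dots>, b + L\<close> and after that every \<open>M\<close>-th number. A random set cannot cross it
  during the first \<open>L\<close> steps. If it crosses between the \<open>l - 1\<close>-st and the \<open>l\<close>-th later element of
  the barrier set, then it has at least \<open>L + l\<close> elements among the first \<open>L + l M - 1\<close> numbers.
\<close>

lemma walk_bound:
  fixes p :: real
  assumes p: "0 \<le> p" "p \<le> 1" and M: "0 < M"
  shows "biased_measure p {b+1..m}
      {R. \<exists>x. min (x - b) L + (x - b - L) div M < card (R \<inter> {b+1..x})}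
    \<le> (\<Sum>l=1..m. real ((L + l * M - 1) choose (L + l)) * p ^ (L + l))"
proof -
  let ?E = "{b+1..m}"
  let ?S = "\<lambda>l. {b+1..min m (b + L + l * M - 1)}"
  have "biased_measure p ?E {R. \<exists>x. min (x - b) L + (x - b - L) div M < card (R \<inter> {b+1..x})}
      \<le> biased_measure p ?E (\<Union>l\<in>{1..m}. {R. L + l \<le> card (R \<inter> ?S l)})"
  proof (rule biased_measure_mono)
    fix R assume R: "R \<subseteq> ?E"
      and "R \<in> {R. \<exists>x. min (x - b) L + (x - b - L) div M < card (R \<inter> {b+1..x})}"
    then obtain x where x: "min (x - b) L + (x - b - L) div M < card (R \<inter> {b+1..x})" by blast
    have fin: "finite R" using R finite_subset by blast
    have "card (R \<inter> {b+1..x}) \<le> card {b+1..x}" by (intro card_mono) auto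
    hence xL: "L < x - b" using x by (simp add: min_def split: if_splits)
    define l where "l = Suc ((x - b - L) div M)"
    have Ll: "L + l \<le> card (R \<inter> {b+1..x})" using x xL by (simp add: l_def)
    also have "\<dots> \<le> card {b+1..m}" using R by (intro card_mono) auto
    finally have lm: "l \<le> m" by simp
    have "x - b - L < l * M"
      using div_less_iff_less_mult[OF M, of "x - b - L" l] by (simp add: l_def)
    hence "x \<le> b + L + l * M - 1" by linarith
    hence "R \<inter> {b+1..x} \<subseteq> R \<inter> ?S l" using R by auto
    hence "card (R \<inter> {b+1..x}) \<le> card (R \<inter> ?S l)" using fin by (intro card_mono) auto
    hence "L + l \<le> card (R \<inter> ?S l)" using Ll by linarith
    thus "R \<in> (\<Union>l\<in>{1..m}. {R. L + l \<le> card (R \<inter> ?S l)})"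
      using lm by (auto simp: l_def intro!: bexI[of _ l])
  qed (use p in auto)
  also have "\<dots> \<le> (\<Sum>l=1..m. biased_measure p ?E {R. L + l \<le> card (R \<inter> ?S l)})"
    using p by (intro biased_measure_Union) auto
  also have "\<dots> \<le> (\<Sum>l=1..m. real ((L + l * M - 1) choose (L + l)) * p ^ (L + l))"
  proof (rule sum_mono)
    fix l
    have "biased_measure p ?E {R. L + l \<le> card (R \<inter> ?S l)}
        \<le> real (card (?S l) choose (L + l)) * p ^ (L + l)"
      using p by (intro biased_measure_card_ge) auto
    also have "\<dots> \<le> real ((L + l * M - 1) choose (L + l)) * p ^ (L + l)"
      using p by (intro mult_right_mono of_nat_mono binomial_right_mono) auto
    finally show "biased_measure p ?E {R. L + l \<le> card (R \<inter> ?S l)}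
        \<le> real ((L + l * M - 1) choose (L + l)) * p ^ (L + l)" .
  qed
  finally show ?thesis .
qed

text \<open>
  The quotients of consecutive terms are \<open>(1 + 1 / l) ^ l \<le> e\<close>. Starting at \<open>l = 2\<close> instead
  of \<open>l = 1\<close> gains the factor \<open>2 / e\<close>, which the numerical estimates below need.
\<close>

lemma power_self_over_fact_le:
  assumes "2 \<le> l"
  shows "real l ^ l / fact l \<le> 2 * exp 1 ^ (l - 2)"
  using assms
proof (induction l rule: dec_induct)
  case base
  show ?case by simp
next
  case (step l)
  have l: "0 < real l" using step by simp
  have "(1 + 1 / real l) ^ l \<le> exp (1 / real l) ^ l"
    by (intro power_mono exp_ge_add_one_self) auto
  also have "\<dots> = exp 1" using l by (simp flip: exp_of_nat_mult)
  finally have e: "(1 + 1 / real l) ^ l \<le> exp 1" .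
  have "real (Suc l) ^ Suc l / fact (Suc l) = real (Suc l) ^ l / fact l"
    by (simp add: field_simps del: of_nat_Suc)
  also have "real (Suc l) ^ l = (real l * (1 + 1 / real l)) ^ l"
    by (rule arg_cong[where f = "\<lambda>x. x ^ l"]) (use l in \<open>simp add: field_simps\<close>)
  also have "(real l * (1 + 1 / real l)) ^ l / fact l = real l ^ l / fact l * (1 + 1 / real l) ^ l"
    by (simp add: power_mult_distrib)
  also have "\<dots> \<le> (2 * exp 1 ^ (l - 2)) * exp 1"
    using step e by (intro mult_mono) auto
  also have "\<dots> = 2 * exp 1 ^ (Suc l - 2)"
    using le_Suc_ex[OF step(1)] by auto
  finally show ?case .
qed

lemma binomial_power_le:
  fixes p :: real
  assumes "0 \<le> p"
  shows "real (N choose j) * p ^ j \<le> (real N * p) ^ j / fact j"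
proof -
  have "real (N choose j) * fact j \<le> real N ^ j"
    using binomial_fact_pow[of N j] by (metis of_nat_fact of_nat_le_iff of_nat_mult of_nat_power)
  hence "real (N choose j) \<le> real N ^ j / fact j" by (simp add: field_simps)
  hence "real (N choose j) * p ^ j \<le> real N ^ j / fact j * p ^ j"
    using assms by (intro mult_right_mono) auto
  thus ?thesis by (simp add: power_mult_distrib)
qed

lemma sum_power_le_geometric:
  fixes x :: real
  assumes "0 \<le> x" "x < 1"
  shows "(\<Sum>l=a..m. x ^ (l - a)) \<le> 1 / (1 - x)"
proof -
  have "(\<Sum>l=a..m. x ^ (l - a)) \<le> (\<Sum>l\<in>{0..<Suc m - a}. x ^ l)"
    using assms by (intro eq_refl sum.reindex_bij_witness[where i = "\<lambda>l. l + a" and j = "\<lambda>l. l - a"]) auto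
  also have "\<dots> \<le> (\<Sum>l. x ^ l)"
    using assms by (intro sum_le_suminf summable_geometric) auto
  also have "\<dots> = 1 / (1 - x)" using assms by (intro suminf_geometric) auto
  finally show ?thesis .
qed

lemma sum_le_first_plus_rest:
  fixes f :: "nat \<Rightarrow> real"
  assumes "f 1 \<le> a" "0 \<le> a" "\<And>l. 2 \<le> l \<Longrightarrow> f l \<le> b * x ^ (l - 2)" "0 \<le> b" "0 \<le> x" "x < 1"
  shows "(\<Sum>l=1..m. f l) \<le> a + b / (1 - x)"
proof (cases "m = 0")
  case True
  thus ?thesis using assms by simp
next
  case False
  hence "(\<Sum>l=1..m. f l) = f 1 + (\<Sum>l=2..m. f l)"
    by (subst sum.atLeast_Suc_atMost) (auto simp: numeral_2_eq_2)
  also have "(\<Sum>l=2..m. f l) \<le> (\<Sum>l=2..m. b * x ^ (l - 2))"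
    using assms by (intro sum_mono) auto
  also have "\<dots> = b * (\<Sum>l=2..m. x ^ (l - 2))" by (simp add: sum_distrib_left)
  also have "\<dots> \<le> b * (1 / (1 - x))"
    using assms by (intro mult_left_mono sum_power_le_geometric) auto
  finally show ?thesis using assms by simp
qed

text \<open>
  With no prefix the leading term is linear in the density \<open>t = M p\<close>: the very first block may
  already contain an element of the random set.
\<close>

lemma walk_sum_no_prefix:
  fixes p t :: real
  assumes p: "0 \<le> p" and t: "t = real M * p" "exp 1 * t \<le> 2 / 3"
  shows "(\<Sum>l=1..m. real ((0 + l * M - 1) choose (0 + l)) * p ^ (0 + l)) \<le> t + 6 * t\<^sup>2"
proof -
  have t0: "0 \<le> t" using p t by simp
  have le: "real ((0 + l * M - 1) choose (0 + l)) * p ^ (0 + l) \<le> real l ^ l / fact l * t ^ l" for l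
  proof -
    have "real ((0 + l * M - 1) choose (0 + l)) * p ^ (0 + l) \<le> real ((l * M) choose l) * p ^ l"
      using p by (auto intro!: mult_right_mono binomial_right_mono)
    also have "\<dots> \<le> (real (l * M) * p) ^ l / fact l" by (rule binomial_power_le[OF p])
    also have "\<dots> = real l ^ l / fact l * t ^ l"
      by (simp add: t power_mult_distrib)
    finally show ?thesis .
  qed
  have "(\<Sum>l=1..m. real ((0 + l * M - 1) choose (0 + l)) * p ^ (0 + l))
      \<le> t + 2 * t\<^sup>2 / (1 - exp 1 * t)"
  proof (rule sum_le_first_plus_rest)
    fix l :: nat assume l: "2 \<le> l"
    have "real ((0 + l * M - 1) choose (0 + l)) * p ^ (0 + l) \<le> real l ^ l / fact l * t ^ l" by (rule le)
    also have "\<dots> \<le> 2 * exp 1 ^ (l - 2) * t ^ l"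
      using t0 power_self_over_fact_le[OF l] by (intro mult_right_mono) auto
    also have "t ^ l = t\<^sup>2 * t ^ (l - 2)" using le_Suc_ex[OF l] by (auto simp: power_add power2_eq_square)
    finally show "real ((0 + l * M - 1) choose (0 + l)) * p ^ (0 + l) \<le> 2 * t\<^sup>2 * (exp 1 * t) ^ (l - 2)"
      by (simp add: power_mult_distrib mult_ac)
  qed (use le[of 1] t0 t in auto)
  also have "2 * t\<^sup>2 / (1 - exp 1 * t) \<le> 2 * t\<^sup>2 / (1 / 3)"
    using t by (intro divide_left_mono) auto
  finally show ?thesis by simp
qed

text \<open>
  One free element at the start makes the crossing probability quadratic in \<open>t = M p\<close>. This is what
  makes it small compared with \<open>k p\<close> when \<open>M\<close> is of order \<open>k\<close>.
\<close>

lemma walk_sum_prefix_1: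
  fixes p t :: real
  assumes p: "0 \<le> p" and t: "t = real M * p" "exp 1 * t \<le> 1 / 3"
  shows "(\<Sum>l=1..m. real ((1 + l * M - 1) choose (1 + l)) * p ^ (1 + l)) \<le> t\<^sup>2 / 2 + 3 * t ^ 3"
proof -
  have t0: "0 \<le> t" using p t by simp
  have le: "real ((1 + l * M - 1) choose (1 + l)) * p ^ (1 + l)
      \<le> real l ^ l / fact l * (real l / real (Suc l)) * t ^ Suc l" for l
  proof -
    have "real ((1 + l * M - 1) choose (1 + l)) * p ^ (1 + l) \<le> (real (l * M) * p) ^ Suc l / fact (Suc l)"
      using binomial_power_le[OF p, of "l * M" "Suc l"] by simp
    also have "\<dots> = (real l * t) ^ Suc l / fact (Suc l)" by (simp add: t mult.assoc)
    also have "\<dots> = real l ^ l / fact l * (real l / real (Suc l)) * t ^ Suc l"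
      by (simp add: power_mult_distrib field_simps)
    finally show ?thesis .
  qed
  have "(\<Sum>l=1..m. real ((1 + l * M - 1) choose (1 + l)) * p ^ (1 + l))
      \<le> t\<^sup>2 / 2 + 2 * t ^ 3 / (1 - exp 1 * t)"
  proof (rule sum_le_first_plus_rest)
    fix l :: nat assume l: "2 \<le> l"
    have "real ((1 + l * M - 1) choose (1 + l)) * p ^ (1 + l)
        \<le> real l ^ l / fact l * (real l / real (Suc l)) * t ^ Suc l" by (rule le)
    also have "\<dots> \<le> (2 * exp 1 ^ (l - 2)) * 1 * t ^ Suc l"
      using t0 power_self_over_fact_le[OF l] by (intro mult_right_mono mult_mono) auto
    also have "t ^ Suc l = t ^ 3 * t ^ (l - 2)" using le_Suc_ex[OF l] by (auto simp: power_add eval_nat_numeral)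
    finally show "real ((1 + l * M - 1) choose (1 + l)) * p ^ (1 + l) \<le> 2 * t ^ 3 * (exp 1 * t) ^ (l - 2)"
      by (simp add: power_mult_distrib mult_ac)
  qed (use le[of 1] t0 t in \<open>auto simp: power2_eq_square\<close>)
  also have "2 * t ^ 3 / (1 - exp 1 * t) \<le> 2 * t ^ 3 / (2 / 3)"
    using t t0 by (intro divide_left_mono) auto
  finally show ?thesis by simp
qed

text \<open>
  For arbitrarily long prefixes the bound \<open>2 ^ N\<close> on binomial coefficients is enough, since only
  exponential decay in \<open>L\<close> matters.
\<close>

lemma walk_sum_step_2:
  fixes p :: real
  assumes p: "0 \<le> p" "4 * p < 1"
  shows "(\<Sum>l=1..m. real ((L + l * 2 - 1) choose (L + l)) * p ^ (L + l)) \<le> (2 * p) ^ L * (2 * p / (1 - 4 * p))"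
proof -
  have "(\<Sum>l=1..m. real ((L + l * 2 - 1) choose (L + l)) * p ^ (L + l))
      \<le> (\<Sum>l=1..m. (2 * p) ^ L * (2 * p) * (4 * p) ^ (l - 1))"
  proof (rule sum_mono)
    fix l assume l: "l \<in> {1..m}"
    have "real ((L + l * 2 - 1) choose (L + l)) \<le> 2 ^ (L + l * 2 - 1)"
      using binomial_le_pow2[of "L + l * 2 - 1" "L + l"] by (metis numeral_power_le_of_nat_cancel_iff of_nat_le_iff of_nat_numeral of_nat_power)
    hence "real ((L + l * 2 - 1) choose (L + l)) * p ^ (L + l) \<le> 2 ^ (L + l * 2 - 1) * p ^ (L + l)"
      using p by (intro mult_right_mono) auto
    also have "\<dots> = (2 * p) ^ L * (2 * p) * (4 * p) ^ (l - 1)"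
    proof -
      obtain k where "l = Suc k" using l by (cases l) auto
      moreover have "L + Suc k * 2 - 1 = L + 1 + 2 * k" by simp
      moreover have "(2::real) ^ (2 * k) = 4 ^ k" by (simp add: power_mult)
      ultimately show ?thesis by (simp only: power_mult_distrib power_add) simp
    qed
    finally show "real ((L + l * 2 - 1) choose (L + l)) * p ^ (L + l)
        \<le> (2 * p) ^ L * (2 * p) * (4 * p) ^ (l - 1)" .
  qed
  also have "\<dots> = (2 * p) ^ L * (2 * p) * (\<Sum>l=1..m. (4 * p) ^ (l - 1))"
    by (simp add: sum_distrib_left)
  also have "\<dots> \<le> (2 * p) ^ L * (2 * p) * (1 / (1 - 4 * p))"
    using p by (intro mult_left_mono sum_power_le_geometric) auto
  finally show ?thesis by simp
qed

lemma card_residue_class: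
  assumes "r < d"
  shows "z div d \<le> card {y \<in> {1..z}. y mod d = r}"
proof -
  define f where "f = (\<lambda>l. if r = 0 then Suc l * d else l * d + r)"
  have "card (f ` {..<z div d}) = z div d"
    using assms by (subst card_image) (auto simp: inj_on_def f_def)
  moreover have "f ` {..<z div d} \<subseteq> {y \<in> {1..z}. y mod d = r}"
  proof
    fix y assume "y \<in> f ` {..<z div d}"
    then obtain l where l: "l < z div d" "y = f l" by auto
    have "Suc l * d \<le> z div d * d" using l by (intro mult_right_mono) auto
    also have "\<dots> \<le> z" by simp
    finally have "Suc l * d \<le> z" .
    thus "y \<in> {y \<in> {1..z}. y mod d = r}" using assms l by (auto simp: f_def)
  qed
  ultimately show ?thesis
    using card_mono[of "{y \<in> {1..z}. y mod d = r}" "f ` {..<z div d}"] by simp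
qed


section \<open>Sets forced into a shifted family\<close>

definition dominated :: "nat set \<Rightarrow> nat set \<Rightarrow> bool" where
  "dominated A S \<longleftrightarrow> (\<forall>x. card (A \<inter> {1..x}) \<le> card (S \<inter> {1..x}))"

lemma tail_measure_le_escape:
  assumes "shifted m F" "upclosed {1..m} F" "S \<subseteq> {1..m}" "S \<notin> F" "0 \<le> p" "p \<le> 1"
  shows "biased_measure p {s+1..m} F \<le> biased_measure p {s+1..m} {R. \<not> dominated R S}"
proof (rule biased_measure_mono)
  fix R assume "R \<in> F"
  thus "R \<in> {R. \<not> dominated R S}"
    using shifted_dominance[OF assms(1-3)] assms(4) unfolding dominated_def by blast
qed (use assms in auto)

text \<open>
  The deficit of a family that misses the set in question is compared with that of the extremal
  family of all sets that meet \<open>{1..s}\<close>. A shifted family without \<open>insert (s + 1 - i) V\<close> misses, for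
  each of the \<open>i\<close> goods \<open>j\<close> from \<open>s + 1 - i\<close> to \<open>s\<close>, all sets that consist of \<open>j\<close> and a dominated set
  beyond \<open>s\<close>. Since it nevertheless has larger measure than the extremal family, its part beyond \<open>s\<close>
  must make up for this loss. The case \<open>i = 0\<close> says that this part is never empty.
\<close>

lemma tail_measure_gt:
  fixes p :: real
  assumes F: "shifted m F" "upclosed {1..m} F"
    and p: "0 < p" "p < 1" and s: "1 \<le> s" "s \<le> m"
    and mu: "biased_measure p {1..m} F > 1 - (1 - p) ^ s"
    and i: "i \<le> s" and V: "V \<subseteq> {s+1..m}" and notin: "i = 0 \<or> insert (s + 1 - i) V \<notin> F"
  shows "(1 - p) * biased_measure p {s+1..m} F > real i * p * biased_measure p {s+1..m} {R. dominated R V}"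
proof -
  let ?T = "{s+1..m}" and ?J = "{s+1-i..s}"
  let ?e = "biased_measure p ?T F" and ?Q = "biased_measure p ?T {R. dominated R V}"
  let ?g = "\<lambda>A. biased_weight p {1..s} A * biased_measure p ?T {R. A \<union> R \<in> - F}"
  have E: "{1..m} = {1..s} \<union> ?T" using s by auto
  have g0: "?g {} = (1 - p) ^ s * (1 - ?e)"
  proof -
    have "{R. {} \<union> R \<in> - F} = - F" by auto
    thus ?thesis by (simp add: biased_weight_def biased_measure_Compl)
  qed
  \<comment> \<open>Dominance moves a member with the good \<open>j\<close> to the missing set, so no such member exists.\<close>
  have g1: "?g {j} \<ge> p * (1 - p) ^ (s - 1) * ?Q" if j: "j \<in> ?J" for j
  proof -
    have j1: "1 \<le> j" "i \<noteq> 0" using j i s by auto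
    have "?Q \<le> biased_measure p ?T {R. {j} \<union> R \<in> - F}"
    proof (rule biased_measure_mono)
      fix R assume R: "R \<subseteq> ?T" "R \<in> {R. dominated R V}"
      have "insert (s + 1 - i) V \<in> F" if jR: "{j} \<union> R \<in> F"
      proof (rule shifted_dominance[OF F _ jR])
        show "insert (s + 1 - i) V \<subseteq> {1..m}" using V i s j1 by auto
        fix x
        show "card (({j} \<union> R) \<inter> {1..x}) \<le> card (insert (s + 1 - i) V \<inter> {1..x})"
        proof (cases "x < j")
          case True
          hence "({j} \<union> R) \<inter> {1..x} = {}" using R j by auto
          thus ?thesis by simp
        next
          case False
          have fin: "finite (R \<inter> {1..x})" "finite (V \<inter> {1..x})" by auto
          have "({j} \<union> R) \<inter> {1..x} = insert j (R \<inter> {1..x})" using False j1 by auto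
          moreover have "j \<notin> R" using R j by auto
          moreover have "insert (s + 1 - i) V \<inter> {1..x} = insert (s + 1 - i) (V \<inter> {1..x})"
            using False j1 j i by auto
          moreover have "s + 1 - i \<notin> V"
          proof
            assume "s + 1 - i \<in> V"
            hence "s + 1 \<le> s + 1 - i" using V by auto
            thus False using j1 i by simp
          qed
          ultimately show ?thesis using fin R(2) by (simp add: dominated_def)
        qed
      qed
      thus "R \<in> {R. {j} \<union> R \<in> - F}" using notin j1 by auto
    qed (use p in auto)
    moreover have "biased_weight p {1..s} {j} = p * (1 - p) ^ (s - 1)"
      using j j1 by (simp add: biased_weight_def card_Diff_singleton)
    ultimately show ?thesis using p by (auto intro!: mult_left_mono)
  qed
  have inj: "inj_on (\<lambda>j. {j}) ?J" by (auto simp: inj_on_def)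
  have "?g {} + (\<Sum>j\<in>?J. ?g {j}) = (\<Sum>A\<in>insert {} ((\<lambda>j. {j}) ` ?J). ?g A)"
  proof -
    have "(\<Sum>A\<in>(\<lambda>j. {j}) ` ?J. ?g A) = (\<Sum>j\<in>?J. ?g {j})"
      by (subst sum.reindex[OF inj]) (simp only: o_def)
    moreover have "{} \<notin> (\<lambda>j. {j}) ` ?J" by auto
    ultimately show ?thesis by (subst sum.insert) simp_all
  qed
  also have "\<dots> \<le> (\<Sum>A\<in>Pow {1..s}. ?g A)"
    using p i by (intro sum_mono2) (auto intro!: mult_nonneg_nonneg biased_weight_nonneg biased_measure_nonneg)
  also have "\<dots> = biased_measure p {1..m} (- F)"
    by (subst E, subst biased_measure_Un) auto
  also have "\<dots> < (1 - p) ^ s" using mu by (simp add: biased_measure_Compl)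
  finally have "(1 - p) ^ s * (1 - ?e) + (\<Sum>j\<in>?J. ?g {j}) < (1 - p) ^ s" by (simp only: g0)
  moreover have "(\<Sum>j\<in>?J. p * (1 - p) ^ (s - 1) * ?Q) \<le> (\<Sum>j\<in>?J. ?g {j})"
    by (intro sum_mono g1)
  ultimately have "real i * (p * (1 - p) ^ (s - 1) * ?Q) < (1 - p) ^ s * ?e"
    using i by (simp add: algebra_simps Suc_diff_le)
  also have "(1 - p) ^ s = (1 - p) ^ (s - 1) * (1 - p)"
    using s by (cases s) auto
  finally have "(1 - p) ^ (s - 1) * (real i * p * ?Q) < (1 - p) ^ (s - 1) * ((1 - p) * ?e)"
    by (simp add: mult_ac)
  thus ?thesis using p by (simp add: mult_less_cancel_left_pos)
qed

lemma escape_le_walk_sum: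
  fixes p :: real
  assumes p: "0 \<le> p" "p \<le> 1" and M: "0 < M"
    and S: "\<And>x. x \<le> m \<Longrightarrow> min (x - b) L + (x - b - L) div M \<le> card (S \<inter> {1..x})"
  shows "biased_measure p {b+1..m} {R. \<not> dominated R S}
      \<le> (\<Sum>l=1..m. real ((L + l * M - 1) choose (L + l)) * p ^ (L + l))"
proof (rule order_trans[OF biased_measure_mono walk_bound[OF p M]])
  fix R assume R: "R \<subseteq> {b+1..m}" "R \<in> {R. \<not> dominated R S}"
  then obtain x where x: "card (S \<inter> {1..x}) < card (R \<inter> {1..x})"
    by (auto simp: dominated_def not_le)
  have eq: "R \<inter> {1..x} = R \<inter> {b+1..min x m}" using R by auto
  have "card (S \<inter> {1..min x m}) \<le> card (S \<inter> {1..x})" by (intro card_mono) auto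
  thus "R \<in> {R. \<exists>x. min (x - b) L + (x - b - L) div M < card (R \<inter> {b+1..x})}"
    using x S[of "min x m"] unfolding eq by (auto intro!: exI[of _ "min x m"])
qed (use p in auto)

text \<open>
  A set that avoids the first \<open>L\<close> places loses only a factor \<open>(1 - p) ^ L\<close>: the random
  set is required to be empty there too.
\<close>

lemma dominated_measure_ge:
  fixes p :: real
  assumes p: "0 \<le> p" "p \<le> 1" and M: "0 < M"
    and V: "\<And>x. x \<le> m \<Longrightarrow> (x - (s + L)) div M \<le> card (V \<inter> {1..x})"
  shows "biased_measure p {s+1..m} {R. dominated R V}
      \<ge> (1 - p) ^ L * (1 - (\<Sum>l=1..m. real ((0 + l * M - 1) choose (0 + l)) * p ^ (0 + l)))"
proof -
  let ?S = "{s+1..min m (s + L)}"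
  let ?q = "biased_measure p {s+L+1..m} {R. \<not> dominated R V}"
  have "(1 - p) ^ L * (1 - (\<Sum>l=1..m. real ((0 + l * M - 1) choose (0 + l)) * p ^ (0 + l)))
      \<le> (1 - p) ^ L * (1 - ?q)"
    using escape_le_walk_sum[OF p M, of m "s + L" 0 V] V p
    by (intro mult_left_mono) auto
  also have "\<dots> \<le> (1 - p) ^ card ?S * (1 - ?q)"
    using p biased_measure_le_1[of "{s+L+1..m}" p]
    by (intro mult_right_mono power_decreasing) auto
  also have "1 - ?q = biased_measure p {s+L+1..m} {R. dominated R V}"
    by (subst biased_measure_Compl[symmetric]) (auto intro!: biased_measure_cong)
  also have "{s+L+1..m} = {s+1..m} - ?S" by auto
  also have "(1 - p) ^ card ?S * biased_measure p ({s+1..m} - ?S) {R. dominated R V}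
      = biased_measure p {s+1..m} {R. R \<inter> ?S = {} \<and> R \<in> {R. dominated R V}}"
    using p by (intro biased_measure_avoid[symmetric]) auto
  also have "\<dots> \<le> biased_measure p {s+1..m} {R. dominated R V}"
    using p by (intro biased_measure_mono) auto
  finally show ?thesis .
qed

section \<open>Residue classes and numerical estimates\<close>

definition progression :: "nat \<Rightarrow> nat \<Rightarrow> nat \<Rightarrow> nat \<Rightarrow> nat set" where
  "progression m b d r = {x \<in> {b+1..m}. (x - b) mod d = r}"

lemma card_progression:
  assumes "r < d" "x \<le> m"
  shows "(x - b) div d \<le> card (progression m b d r \<inter> {1..x})"
proof -
  let ?Y = "{y \<in> {1..x - b}. y mod d = r}"
  have "(x - b) div d \<le> card ?Y" by (rule card_residue_class) fact
  also have "\<dots> = card ((+) b ` ?Y)" by (simp add: card_image)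
  also have "\<dots> \<le> card (progression m b d r \<inter> {1..x})"
    using assms by (intro card_mono) (auto simp: progression_def)
  finally show ?thesis .
qed

text \<open>
  Families up to \<open>k\<close> share the odd numbers and the others share the even ones. If \<open>2 (k + 1)\<close> is
  larger than the number \<open>s + 1\<close> of families, then each family gets its own residue class modulo
  \<open>s + 1\<close> instead: the hypothesis on \<open>t\<close> in \<open>dense_walk_estimate\<close> is only available for moduli up
  to \<open>s + 1\<close>.
\<close>

lemma disjoint_progressions:
  fixes k s :: nat
  assumes "k \<le> s"
  shows "\<exists>d r :: nat \<Rightarrow> nat.
    (\<forall>i\<le>s. r i < d i) \<and>
    (\<forall>i\<le>k. d i = min (2 * (k + 1)) (s + 1)) \<and>
    (\<forall>i\<le>s. d i \<le> 2 * (s + 1)) \<and>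
    (\<forall>i\<le>s. \<forall>j\<le>s. \<forall>y. y mod d i = r i \<longrightarrow> y mod d j = r j \<longrightarrow> i = j)"
proof (cases "2 * (k + 1) \<le> s + 1")
  case False
  show ?thesis
    by (rule exI[of _ "\<lambda>_. s + 1"], rule exI[of _ "\<lambda>i. i"]) (use False in auto)
next
  case True
  define d where "d = (\<lambda>i. if i \<le> k then 2 * (k + 1) else 2 * (s + 1))"
  define r where "r = (\<lambda>i. if i \<le> k then 2 * i + 1 else 2 * i)"
  have parity: "odd y \<longleftrightarrow> i \<le> k" if "y mod d i = r i" for i y
  proof -
    have "even (d i)" by (simp add: d_def)
    hence "even (y mod d i) \<longleftrightarrow> even y" by (simp add: dvd_mod_iff)
    thus ?thesis using that by (auto simp: r_def split: if_splits)
  qed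
  have 4: "i = j" if "y mod d i = r i" "y mod d j = r j" for i j y
  proof -
    have iff: "i \<le> k \<longleftrightarrow> j \<le> k" using parity that by blast
    hence "d i = d j" by (simp add: d_def)
    hence "r i = r j" using that by simp
    thus ?thesis using iff by (auto simp: r_def split: if_splits)
  qed
  have 1: "r i < d i" if "i \<le> s" for i using that by (auto simp: d_def r_def)
  have 2: "d i = min (2 * (k + 1)) (s + 1)" if "i \<le> k" for i using True that by (simp add: d_def)
  have 3: "d i \<le> 2 * (s + 1)" if "i \<le> s" for i using assms by (simp add: d_def)
  show ?thesis
    by (rule exI[of _ d], rule exI[of _ r], intro conjI allI impI) (fact 1 2 3, fact 1 2 3, fact 1 2 3, rule 4)
qed

lemma exp_1_ge: "exp 1 \<ge> (27 / 10 :: real)"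
  using e_approx_32 by (simp add: abs_if split: if_splits)

text \<open>
  A random set is dominated by a residue class modulo \<open>2 n\<close> with probability at least \<open>19 / 50\<close>;
  together with \<open>p \<le> 1 / 48\<close> this leaves more than the fraction \<open>1 / 3\<close> used to separate the
  two kinds of families.
\<close>

lemma sparse_walk_estimate:
  fixes t :: real
  assumes "0 \<le> t" "exp 1 * t \<le> 2 / 3"
  shows "t + 6 * t\<^sup>2 \<le> 31 / 50"
proof -
  have "27 / 10 * t \<le> exp 1 * t" using exp_1_ge assms by (intro mult_right_mono) auto
  hence t: "t \<le> 20 / 81" using assms by linarith
  hence "t * t \<le> 20 / 81 * (20 / 81)" using assms by (intro mult_mono) auto
  thus ?thesis using t by (simp add: power2_eq_square)
qed

text \<open>
  For \<open>k \<ge> 2\<close> one has \<open>t \<le> 3 k p\<close>, and \<open>t / 2 + 3 t\<^sup>2 \<le> 1 / 9\<close> holds with little room when \<open>t\<close> is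
  near \<open>1 / (3 e)\<close>. For \<open>k = 1\<close> only \<open>t \<le> 4 p\<close> is available, and \<open>p \<le> 1 / 48\<close> compensates for it.
\<close>

lemma dense_walk_estimate:
  fixes p t :: real
  assumes p: "0 < p" "p \<le> 1 / 48" and t: "t = real M * p" "exp 1 * t \<le> 1 / 3"
    and k: "1 \<le> k" and M: "M \<le> 2 * (k + 1)"
  shows "t\<^sup>2 / 2 + 3 * t ^ 3 \<le> real k * p / 3"
proof -
  have t0: "0 \<le> t" using p t by simp
  have "27 / 10 * t \<le> exp 1 * t" using exp_1_ge t0 by (intro mult_right_mono) auto
  hence t1: "t \<le> 10 / 81" using t by linarith
  have tk: "t \<le> 2 * (real k + 1) * p"
    unfolding t using M p by (intro mult_right_mono) (auto simp flip: of_nat_le_iff[where 'a = real])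
  have *: "t\<^sup>2 / 2 + 3 * t ^ 3 = t * (t / 2 + 3 * t * t)" by (simp add: power2_eq_square power3_eq_cube field_simps)
  show ?thesis
  proof (cases "k = 1")
    case True
    have t2: "t \<le> 1 / 12" using tk p True by simp
    have "t * t \<le> 1 / 12 * (1 / 12)" using t2 t0 by (intro mult_mono) auto
    hence "t / 2 + 3 * t * t \<le> 1 / 16" using t2 by simp
    hence "t * (t / 2 + 3 * t * t) \<le> 4 * p * (1 / 16)"
      using tk t0 True p by (intro mult_mono) auto
    thus ?thesis unfolding * using True p by simp
  next
    case False
    hence k2: "2 \<le> real k" using k by simp
    have "t * t \<le> 10 / 81 * (10 / 81)" using t1 t0 by (intro mult_mono) auto
    hence le: "t / 2 + 3 * t * t \<le> 1 / 9" using t1 by simp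
    have "2 * (real k + 1) * p \<le> 3 * real k * p" using k2 p by (intro mult_right_mono) auto
    hence "t \<le> 3 * real k * p" using tk by linarith
    hence "t * (t / 2 + 3 * t * t) \<le> 3 * real k * p * (1 / 9)"
      using le t0 p by (intro mult_mono) auto
    thus ?thesis unfolding * by (simp add: field_simps)
  qed
qed

text \<open>
  With \<open>L\<close> the length of a prefix that is one too short, the left side bounds \<open>(1 - p) \<epsilon>\<^sub>0\<close>; the right
  side is \<open>p\<close> times a lower bound for the probability of being dominated by a residue class that
  starts after a prefix of length \<open>L + 1\<close>.
\<close>

lemma long_prefix_estimate:
  fixes p :: real
  assumes p: "0 < p" "p \<le> 1 / 48" and L: "1 \<le> L"
  shows "(1 - p) * ((2 * p) ^ L * (2 * p / (1 - 4 * p))) \<le> p * ((1 - p) ^ Suc L * (19 / 50))"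
proof -
  obtain j where j: "L = Suc j" using L by (cases L) auto
  have "(2 * p) ^ j \<le> (1 - p) ^ j" using p by (intro power_mono) auto
  moreover have "2 * p * (2 / (1 - 4 * p)) \<le> (1 - p) * (19 / 50)"
  proof -
    have "2 * p * (2 / (1 - 4 * p)) \<le> 2 * (1 / 48) * (2 / (11 / 12))"
      using p by (intro mult_mono divide_left_mono) auto
    also have "\<dots> \<le> (1 - 1 / 48) * (19 / 50)" by simp
    also have "\<dots> \<le> (1 - p) * (19 / 50)" using p by (intro mult_right_mono) auto
    finally show ?thesis .
  qed
  moreover have "0 \<le> (1 - p) ^ j" "0 \<le> 2 * p * (2 / (1 - 4 * p))" using p by auto
  ultimately have "(2 * p) ^ j * (2 * p * (2 / (1 - 4 * p))) \<le> (1 - p) ^ j * ((1 - p) * (19 / 50))"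
    by (rule mult_mono)
  hence "((1 - p) * p) * ((2 * p) ^ j * (2 * p * (2 / (1 - 4 * p))))
      \<le> ((1 - p) * p) * ((1 - p) ^ j * ((1 - p) * (19 / 50)))"
    using p by (intro mult_left_mono) auto
  moreover have "((1 - p) * p) * ((2 * p) ^ j * (2 * p * (2 / (1 - 4 * p))))
      = (1 - p) * ((2 * p) ^ L * (2 * p / (1 - 4 * p)))"
    by (simp add: j mult_ac)
  moreover have "((1 - p) * p) * ((1 - p) ^ j * ((1 - p) * (19 / 50)))
      = p * ((1 - p) ^ Suc L * (19 / 50))"
    by (simp add: j)
  ultimately show ?thesis by linarith
qed

lemma empty_mem_if_measure_large:
  fixes p :: real
  assumes "finite E" "0 \<le> p" "p \<le> 1" "biased_measure p E F > 1 - (1 - p) ^ card E"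
  shows "{} \<in> F"
proof (rule ccontr)
  assume "{} \<notin> F"
  hence "biased_measure p E {A. A \<inter> E = {} \<and> A \<in> UNIV} \<le> biased_measure p E (- F)"
    using assms by (intro biased_measure_mono) (auto simp: Int_absorb2 inf.absorb1)
  moreover have "biased_measure p E {A. A \<inter> E = {} \<and> A \<in> UNIV} = (1 - p) ^ card E"
    using assms by (subst biased_measure_avoid) (auto simp: biased_measure_UNIV)
  ultimately show False using assms by (simp add: biased_measure_Compl)
qed


section \<open>Disjoint members of families of large measure\<close>

text \<open>
  The set offered to a family with large \<open>\<epsilon>\<^sub>i\<close>: a good \<open>j \<le> s + 1\<close>, the further prefix up to \<open>s + L\<close>,
  and a residue class. Its prefix counts beyond \<open>s\<close> are at least those of the barrier in \<open>walk_bound\<close>,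
  whichever \<open>j\<close> is chosen.
\<close>

definition prefixed :: "nat \<Rightarrow> nat \<Rightarrow> nat \<Rightarrow> nat \<Rightarrow> nat \<Rightarrow> nat \<Rightarrow> nat set" where
  "prefixed m s L j d r = (insert j {s+2..s+L} \<inter> {1..m}) \<union> progression m (s + L) d r"

lemma progression_subset: "progression m b d r \<subseteq> {b+1..m}"
  by (auto simp: progression_def)

lemma card_prefixed:
  assumes "r < d" "x \<le> m" "1 \<le> j" "j \<le> s + 1" "1 \<le> L"
  shows "min (x - s) L + (x - s - L) div d \<le> card (prefixed m s L j d r \<inter> {1..x})"
proof (cases "x \<le> s")
  case True
  thus ?thesis by simp
next
  case False
  let ?P = "{s+2..min x (s + L)}" and ?R = "progression m (s + L) d r \<inter> {1..x}"
  have "insert j ?P \<union> ?R \<subseteq> prefixed m s L j d r \<inter> {1..x}"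
    using assms False by (auto simp: prefixed_def)
  hence "card (insert j ?P \<union> ?R) \<le> card (prefixed m s L j d r \<inter> {1..x})"
    by (intro card_mono) auto
  moreover have "card (insert j ?P \<union> ?R) = card (insert j ?P) + card ?R"
    using assms progression_subset[of m "s + L" d r] by (intro card_Un_disjoint) auto
  moreover have "card (insert j ?P) = min (x - s) L"
    using assms False by simp
  moreover have "(x - (s + L)) div d \<le> card ?R"
    using assms by (intro card_progression) auto
  ultimately show ?thesis by simp
qed

text \<open>
  The threshold \<open>i p / 3\<close> for \<open>(1 - p) \<epsilon>\<^sub>i\<close> separates the two kinds of families; \<open>1 / 3\<close> lies between
  what \<open>dense_walk_estimate\<close> needs and what \<open>sparse_walk_estimate\<close> provides.
\<close>

lemma rainbow_sorted:
  fixes p :: real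
  assumes s: "1 \<le> s" and p: "0 < p" "p \<le> 1 / 48" "exp 1 * (real (s + 1) * p) \<le> 1 / 3"
    and F: "\<And>i. i \<le> s \<Longrightarrow> shifted m (F i)" "\<And>i. i \<le> s \<Longrightarrow> upclosed {1..m} (F i)"
    and mu: "\<And>i. i \<le> s \<Longrightarrow> biased_measure p {1..m} (F i) > 1 - (1 - p) ^ s"
    and sorted: "\<And>i j. i \<le> j \<Longrightarrow> j \<le> s \<Longrightarrow>
      biased_measure p {s+1..m} (F j) \<le> biased_measure p {s+1..m} (F i)"
  shows "rainbow {..s} F"
proof (cases "s \<le> m")
  case False
  \<comment> \<open>With fewer than \<open>s\<close> goods the measure forces the empty set into every family.\<close>
  have "{} \<in> F i" if "i \<le> s" for i
  proof (rule empty_mem_if_measure_large[of "{1..m}" p])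
    have "(1 - p) ^ s \<le> (1 - p) ^ card {1..m}" using p False by (intro power_decreasing) auto
    thus "1 - (1 - p) ^ card {1..m} < biased_measure p {1..m} (F i)" using mu[OF that] by linarith
  qed (use p in auto)
  thus ?thesis unfolding rainbow_def
    by (intro exI[of _ "\<lambda>_. {}"]) (auto simp: disjoint_family_on_def)
next
  case sm: True
  define e where "e = (\<lambda>i. biased_measure p {s+1..m} (F i))"
  define walk where "walk = (\<lambda>L M. \<Sum>l=1..m. real ((L + l * M - 1) choose (L + l)) * p ^ (L + l))"
  have p1: "p < 1" "0 \<le> p" "p \<le> 1" using p by auto
  have epos: "0 < e i" if "i \<le> s" for i
    using tail_measure_gt[OF F[OF that] p(1) p1(1) s sm mu[OF that], of 0 "{}"] p
    by (simp add: e_def zero_less_mult_iff)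
  have e_mono: "e j \<le> e i" if "i \<le> j" "j \<le> s" for i j
    using sorted[OF that] by (simp add: e_def)
  define K where "K = {i. i \<le> s \<and> real i * p / 3 < (1 - p) * e i}"
  define k where "k = Max K"
  have K: "finite K" "0 \<in> K" using epos[of 0] p by (auto simp: K_def)
  have "k \<in> K" unfolding k_def using K by (intro Max_in) auto
  hence k: "k \<le> s" "real k * p / 3 < (1 - p) * e k" by (auto simp: K_def)
  have above_k: "(1 - p) * e i \<le> real i * p / 3" if "k < i" "i \<le> s" for i
  proof (rule ccontr)
    assume "\<not> ?thesis"
    hence "i \<in> K" using that by (auto simp: K_def)
    hence "i \<le> k" unfolding k_def using K by (intro Max_ge) auto
    thus False using that by simp
  qed
  obtain d r where "\<forall>i\<le>s. r i < d i"
      "\<forall>i\<le>k. d i = min (2 * (k + 1)) (s + 1)"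
      "\<forall>i\<le>s. d i \<le> 2 * (s + 1)"
      "\<forall>i\<le>s. \<forall>j\<le>s. \<forall>y. y mod d i = r i \<longrightarrow> y mod d j = r j \<longrightarrow> i = j"
    using disjoint_progressions[OF k(1)] by (elim exE conjE)
  note dr = this[rule_format]
  define S where "S = (\<lambda>L i. prefixed m s L (s + 1 - k + i) (d i) (r i))"
  have S_sub: "S L i \<subseteq> {1..m}" for L i
    by (auto simp: S_def prefixed_def progression_def)
  have e_le_walk: "e i \<le> walk L (d i)" if i: "i \<le> k" and L: "1 \<le> L" and notin: "S L i \<notin> F i" for i L
  proof -
    have i_s: "i \<le> s" using i k by simp
    have "e i \<le> biased_measure p {s+1..m} {R. \<not> dominated R (S L i)}"
      unfolding e_def using tail_measure_le_escape[OF F[OF i_s] S_sub notin] p1 by simp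
    also have "\<dots> \<le> walk L (d i)" unfolding walk_def
    proof (rule escape_le_walk_sum)
      show "0 < d i" using dr(1)[OF i_s] by simp
      show "min (x - s) L + (x - s - L) div d i \<le> card (S L i \<inter> {1..x})" if "x \<le> m" for x
        unfolding S_def using dr(1)[OF i_s] that k i L by (intro card_prefixed) auto
    qed (use p1 in auto)
    finally show ?thesis .
  qed
  obtain L where L: "1 \<le> L" "k = 0 \<or> L = 1" "\<And>i. i \<le> k \<Longrightarrow> S L i \<in> F i"
      "L = 1 \<or> (1 - p) * e 0 \<le> p * ((1 - p) ^ L * (19 / 50))"
  proof (cases "k = 0")
    case False
    have "S 1 i \<in> F i" if i: "i \<le> k" for i
    proof (rule ccontr)
      assume notin: "S 1 i \<notin> F i"
      define t where "t = real (d i) * p"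
      have "d i \<le> s + 1" using dr(2)[OF i] by simp
      hence "real (d i) \<le> real (s + 1)" by (rule of_nat_mono)
      hence "exp 1 * t \<le> exp 1 * (real (s + 1) * p)"
        unfolding t_def using p by (intro mult_left_mono mult_right_mono) auto
      hence t: "exp 1 * t \<le> 1 / 3" using p(3) by linarith
      have "e i \<le> walk 1 (d i)" by (rule e_le_walk[OF i _ notin]) simp
      also have "\<dots> \<le> t\<^sup>2 / 2 + 3 * t ^ 3"
        unfolding walk_def using walk_sum_prefix_1[OF p1(2) t_def t] by simp
      also have "\<dots> \<le> real k * p / 3"
        using False dr(2)[OF i] by (intro dense_walk_estimate[OF p(1,2) t_def t]) auto
      also have "\<dots> < (1 - p) * e k" by (rule k(2))
      also have "\<dots> \<le> 1 * e k" using p epos[OF k(1)] by (intro mult_right_mono) auto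
      also have "\<dots> \<le> e i" using e_mono[OF i k(1)] by simp
      finally show False by simp
    qed
    thus ?thesis by (intro that[of 1]) auto
  next
    case True
    \<comment> \<open>Only one family is of the first kind, so a prefix of any length is available to it.\<close>
    define P where "P = (\<lambda>L. 1 \<le> L \<and> S L 0 \<in> F 0)"
    have "P (Suc m)"
    proof -
      have "\<exists>R. R \<subseteq> {s+1..m} \<and> R \<in> F 0"
      proof (rule ccontr)
        assume "\<not> ?thesis"
        hence "e 0 = biased_measure p {s+1..m} {}"
          unfolding e_def by (intro biased_measure_cong) auto
        thus False using epos[of 0] by (simp add: biased_measure_def)
      qed
      then obtain R where R: "R \<subseteq> {s+1..m}" "R \<in> F 0" by blast
      have "R \<subseteq> S (Suc m) 0" using R(1) True by (auto simp: S_def prefixed_def)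
      thus ?thesis using upclosedD[OF F(2) R(2)] S_sub by (simp add: P_def)
    qed
    define L where "L = (LEAST L. P L)"
    have PL: "P L" unfolding L_def using \<open>P (Suc m)\<close> by (rule LeastI)
    have "(1 - p) * e 0 \<le> p * ((1 - p) ^ L * (19 / 50))" if L1: "L \<noteq> 1"
    proof -
      obtain L' where L': "L = Suc L'" "1 \<le> L'" using PL L1 by (cases L) (auto simp: P_def)
      have "\<not> P L'" using not_less_Least[of L' P] L' by (simp add: L_def)
      hence "e 0 \<le> walk L' (d 0)" using L' by (intro e_le_walk) (auto simp: P_def)
      also have "d 0 = 2" using dr(2)[of 0] True s by simp
      also have "walk L' 2 \<le> (2 * p) ^ L' * (2 * p / (1 - 4 * p))"
        unfolding walk_def using p by (intro walk_sum_step_2) auto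
      finally have "(1 - p) * e 0 \<le> (1 - p) * ((2 * p) ^ L' * (2 * p / (1 - 4 * p)))"
        using p by (intro mult_left_mono) auto
      also have "\<dots> \<le> p * ((1 - p) ^ Suc L' * (19 / 50))"
        by (rule long_prefix_estimate[OF p(1,2) L'(2)])
      finally show ?thesis by (simp add: L')
    qed
    thus ?thesis using PL True by (intro that[of L]) (auto simp: P_def)
  qed
  define V where "V = (\<lambda>i. progression m (s + L) (d i) (r i))"
  have regular: "insert (s + 1 - i) (V i) \<in> F i" if i: "k < i" "i \<le> s" for i
  proof (rule ccontr)
    assume notin: "insert (s + 1 - i) (V i) \<notin> F i"
    let ?Q = "biased_measure p {s+1..m} {R. dominated R (V i)}"
    define t where "t = real (2 * (s + 1)) * p"
    have t: "0 \<le> t" "exp 1 * t \<le> 2 / 3" using p by (auto simp: t_def algebra_simps)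
    have Vsub: "V i \<subseteq> {s+1..m}" by (auto simp: V_def progression_def)
    have V: "(x - (s + L)) div (2 * (s + 1)) \<le> card (V i \<inter> {1..x})" if "x \<le> m" for x
    proof -
      have "(x - (s + L)) div (2 * (s + 1)) \<le> (x - (s + L)) div d i"
        using dr(1,3)[OF i(2)] by (intro div_le_mono2) auto
      also have "\<dots> \<le> card (V i \<inter> {1..x})"
        unfolding V_def using dr(1)[OF i(2)] that by (intro card_progression)
      finally show ?thesis .
    qed
    have "(1 - p) ^ L * (19 / 50) \<le> (1 - p) ^ L * (1 - walk 0 (2 * (s + 1)))"
      using walk_sum_no_prefix[OF p1(2) t_def t(2), of m] sparse_walk_estimate[OF t] p
      by (intro mult_left_mono) (auto simp: walk_def)
    also have "\<dots> \<le> ?Q"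
      unfolding walk_def using p1 V by (intro dominated_measure_ge) auto
    finally have Q: "(1 - p) ^ L * (19 / 50) \<le> ?Q" .
    have gt: "real i * p * ?Q < (1 - p) * e i"
      unfolding e_def by (rule tail_measure_gt[OF F[OF i(2)] p(1) p1(1) s sm mu[OF i(2)] i(2) Vsub])
        (use notin in simp)
    show False
    proof (cases "L = 1")
      case True
      have "1 / 3 \<le> ?Q" using Q True p by simp
      hence "real i * p * (1 / 3) \<le> real i * p * ?Q" using p by (intro mult_left_mono) auto
      thus False using gt above_k[OF i] by simp
    next
      case False
      have "(1 - p) * e i \<le> (1 - p) * e 0" using e_mono[of 0 i] i p by (intro mult_left_mono) auto
      also have "\<dots> \<le> p * ((1 - p) ^ L * (19 / 50))" using L(4) False by blast
      also have "\<dots> \<le> p * ?Q" using Q p by (intro mult_left_mono) auto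
      also have "\<dots> \<le> real i * p * ?Q"
        using i p biased_measure_nonneg[OF p1(2,3)] by (intro mult_right_mono) auto
      finally show False using gt by simp
    qed
  qed
  define B where "B = (\<lambda>i. if i \<le> k then S L i else insert (s + 1 - i) (V i))"
  define h where "h = (\<lambda>i. if i \<le> k then s + 1 - k + i else s + 1 - i)"
  have B_mem: "B i \<in> F i" if "i \<le> s" for i
    using that L(3) regular by (auto simp: B_def)
  \<comment> \<open>The goods up to \<open>s + 1\<close> are separated by \<open>h\<close>, those after \<open>s + L\<close> by residues.\<close>
  have Bcases: "x = h i \<or> (i = 0 \<and> k = 0 \<and> x \<in> {s+2..s+L}) \<or> (s + L < x \<and> (x - (s + L)) mod d i = r i)"
    if "x \<in> B i" for x i
    using that L(1,2) by (auto simp: B_def h_def S_def prefixed_def V_def progression_def split: if_splits)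
  have h_le: "h i \<le> s + 1" for i using k(1) by (auto simp: h_def)
  have h_inj: "i = j" if "h i = h j" "i \<le> s" "j \<le> s" for i j
    using that k(1) by (auto simp: h_def split: if_splits)
  have "disjoint_family_on B {..s}"
    unfolding disjoint_family_on_def
  proof (intro ballI impI)
    fix i j assume ij: "i \<in> {..s}" "j \<in> {..s}" "i \<noteq> j"
    show "B i \<inter> B j = {}"
    proof (rule ccontr)
      assume "B i \<inter> B j \<noteq> {}"
      then obtain x where x: "x \<in> B i" "x \<in> B j" by blast
      show False
      proof (cases "s + L < x")
        case True
        hence "(x - (s + L)) mod d i = r i" "(x - (s + L)) mod d j = r j"
          using Bcases[OF x(1)] Bcases[OF x(2)] h_le[of i] h_le[of j] L(1) by auto
        thus False using dr(4)[of i j "x - (s + L)"] ij by auto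
      next
        case False
        hence "x = h i \<or> (i = 0 \<and> s + 2 \<le> x)" "x = h j \<or> (j = 0 \<and> s + 2 \<le> x)"
          using Bcases[OF x(1)] Bcases[OF x(2)] by auto
        thus False using h_le[of i] h_le[of j] h_inj[of i j] ij by auto
      qed
    qed
  qed
  thus ?thesis using B_mem by (auto simp: rainbow_def)
qed

lemma rainbow_reindex:
  assumes "bij_betw f I J" "rainbow I (\<lambda>i. F (f i))"
  shows "rainbow J F"
proof -
  obtain B where B: "disjoint_family_on B I" "\<And>i. i \<in> I \<Longrightarrow> B i \<in> F (f i)"
    using assms by (auto simp: rainbow_def)
  let ?g = "the_inv_into I f"
  have g: "?g j \<in> I" "f (?g j) = j" if "j \<in> J" for j
    using assms(1) that by (auto simp: bij_betw_def the_inv_into_into f_the_inv_into_f)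
  have "disjoint_family_on (\<lambda>j. B (?g j)) J"
    unfolding disjoint_family_on_def
  proof (intro ballI impI)
    fix i j assume "i \<in> J" "j \<in> J" "i \<noteq> j"
    moreover from this have "?g i \<noteq> ?g j" using g by metis
    ultimately show "B (?g i) \<inter> B (?g j) = {}" using B(1) g by (auto simp: disjoint_family_on_def)
  qed
  moreover have "B (?g j) \<in> F j" if "j \<in> J" for j using B(2)[OF g(1)[OF that]] g(2)[OF that] by simp
  ultimately show ?thesis by (auto simp: rainbow_def)
qed

lemma ex_antimono_enumeration:
  fixes e :: "nat \<Rightarrow> 'a :: linorder"
  shows "\<exists>f. bij_betw f {..s} {1..s+1} \<and> (\<forall>i j. i \<le> j \<longrightarrow> j \<le> s \<longrightarrow> e (f j) \<le> e (f i))"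
proof -
  let ?xs = "rev (sort_key e [1..<s+2])"
  have len: "length ?xs = s + 1" by simp
  have sorted: "sorted (rev (map e ?xs))" by (simp add: rev_map)
  have "bij_betw ((!) ?xs) {..<length ?xs} (set ?xs)"
    by (rule bij_betw_nth) auto
  moreover have "{..<length ?xs} = {..s}" "set ?xs = {1..s+1}" by auto
  ultimately have "bij_betw ((!) ?xs) {..s} {1..s+1}" by metis
  moreover have "e (?xs ! j) \<le> e (?xs ! i)" if "i \<le> j" "j \<le> s" for i j
    using sorted_rev_nth_mono[OF sorted that(1)] that len by simp
  ultimately show ?thesis by blast
qed

lemma rainbow_if_biased_measure_gt:
  fixes p :: real and m :: nat and F :: "nat \<Rightarrow> nat set set"
  assumes n: "2 \<le> n" and p: "0 < p" "p \<le> 1 / 48" "exp 1 * (real n * p) \<le> 1 / 3"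
    and F: "\<And>i. i \<in> {1..n} \<Longrightarrow> upclosed {1..m} (F i)"
    and mu: "\<And>i. i \<in> {1..n} \<Longrightarrow> biased_measure p {1..m} (F i) > 1 - (1 - p) ^ (n - 1)"
  shows "rainbow {1..n} F"
proof (rule rainbow_if_shifted_rainbow[where p = p and m = m and z = "1 - (1 - p) ^ (n - 1)"])
  fix G :: "nat \<Rightarrow> nat set set"
  assume G: "\<And>i. i \<in> {1..n} \<Longrightarrow> upclosed {1..m} (G i) \<and> shifted m (G i) \<and>
      biased_measure p {1..m} (G i) > 1 - (1 - p) ^ (n - 1)"
  define s where "s = n - 1"
  have s: "1 \<le> s" "n = s + 1" using n by (auto simp: s_def)
  obtain f where f: "bij_betw f {..s} {1..s+1}"
      "\<And>i j. i \<le> j \<Longrightarrow> j \<le> s \<Longrightarrow>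
        biased_measure p {s+1..m} (G (f j)) \<le> biased_measure p {s+1..m} (G (f i))"
    using ex_antimono_enumeration[of s "\<lambda>i. biased_measure p {s+1..m} (G i)"] by metis
  have fi: "f i \<in> {1..n}" if "i \<le> s" for i
    using bij_betwE[OF f(1)] that s by simp
  have Gf: "upclosed {1..m} (G (f i))" "shifted m (G (f i))"
      "biased_measure p {1..m} (G (f i)) > 1 - (1 - p) ^ s" if "i \<le> s" for i
    using G[OF fi[OF that]] by (simp_all add: s_def)
  have "rainbow {..s} (\<lambda>i. G (f i))"
  proof (rule rainbow_sorted[OF s(1) p(1,2)])
    show "exp 1 * (real (s + 1) * p) \<le> 1 / 3" using p(3) s by simp
  qed (fact Gf f(2))+
  thus "rainbow {1..n} G" using rainbow_reindex[OF f(1)] s by simp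
next
  show "upclosed {1..m} (F i) \<and> biased_measure p {1..m} (F i) > 1 - (1 - p) ^ (n - 1)"
    if "i \<in> {1..n}" for i using F[OF that] mu[OF that] by simp
qed simp

section \<open>Feasibility of quantile shares\<close>

text \<open>
  For \<open>t\<close> the largest value below the share, less than \<open>q\<close> of the mass lies on bundles worth at most
  \<open>t\<close>, that is, on bundles worth less than the share.
\<close>

lemma share_feasible_core:
  assumes n: "2 \<le> n" and c: "0 < c" "c / real n \<le> 1 / 48" "exp 1 * c \<le> 1 / 3"
    and q: "0 < q" "q \<le> (1 - c / real n) ^ (n - 1)"
  shows "share_feasible n c q"
  unfolding share_feasible_def
proof (intro allI impI)
  fix m and v :: "nat \<Rightarrow> nat set \<Rightarrow> real"
  assume v: "\<forall>i\<in>{1..n}. monotone_valuation m (v i)"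
  define p where "p = c / real n"
  have p: "0 < p" "p \<le> 1 / 48" "real n * p = c" using n c by (auto simp: p_def)
  have cn: "0 \<le> c" "c \<le> real n" using p n c by (auto simp: p_def divide_le_eq)
  define \<tau> where "\<tau> = (\<lambda>i. quantile_share m n c q (v i))"
  define F where "F = (\<lambda>i. {A. A \<subseteq> {1..m} \<and> \<tau> i \<le> v i A})"
  have up: "upclosed {1..m} (F i)" if "i \<in> {1..n}" for i
    unfolding upclosed_def
  proof (intro conjI ballI allI impI)
    fix A B assume "A \<in> F i" "A \<subseteq> B" "B \<subseteq> {1..m}"
    moreover from this have "v i A \<le> v i B"
      using v that by (simp add: monotone_valuation_def)
    ultimately show "B \<in> F i" by (simp add: F_def)
  qed (auto simp: F_def)
  have mu: "biased_measure p {1..m} (F i) > 1 - (1 - p) ^ (n - 1)" if i: "i \<in> {1..n}" for i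
  proof -
    let ?low = "{t \<in> v i ` Pow {1..m}. t < \<tau> i}"
    have "biased_measure p {1..m} (- F i) < q"
    proof (cases "?low = {}")
      case True
      have "biased_measure p {1..m} (- F i) = biased_measure p {1..m} {}"
        using True by (intro biased_measure_cong) (auto simp: F_def not_le)
      thus ?thesis using q by (simp add: biased_measure_def)
    next
      case False
      define t where "t = Max ?low"
      have "t \<in> ?low" unfolding t_def using False by (intro Max_in) auto
      hence t: "t \<in> v i ` Pow {1..m}" "t < \<tau> i" by auto
      have "\<not> q \<le> measure_pmf.prob (thinned_bundle m n c) {X. v i X \<le> t}"
      proof
        assume "q \<le> measure_pmf.prob (thinned_bundle m n c) {X. v i X \<le> t}"
        hence "\<tau> i \<le> t" unfolding \<tau>_def quantile_share_def using t by (intro Min_le) auto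
        thus False using t by simp
      qed
      hence "biased_measure p {1..m} {X. v i X \<le> t} < q"
        using prob_thinned_bundle[OF cn] by (simp add: p_def)
      moreover have "biased_measure p {1..m} (- F i) \<le> biased_measure p {1..m} {X. v i X \<le> t}"
      proof (rule biased_measure_mono)
        fix A assume "A \<subseteq> {1..m}" "A \<in> - F i"
        hence "v i A \<in> ?low" by (auto simp: F_def)
        thus "A \<in> {X. v i X \<le> t}" unfolding t_def by (auto intro!: Max_ge)
      qed (use p in auto)
      ultimately show ?thesis by simp
    qed
    thus ?thesis using q by (simp add: biased_measure_Compl p_def)
  qed
  have "rainbow {1..n} F"
    using n p c up mu by (intro rainbow_if_biased_measure_gt[of n p m]) auto
  then obtain B where B: "disjoint_family_on B {1..n}" "\<And>i. i \<in> {1..n} \<Longrightarrow> B i \<in> F i"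
    by (auto simp: rainbow_def)
  define S where "S = B(1 := B 1 \<union> ({1..m} - (\<Union>i\<in>{1..n}. B i)))"
  have Bsub: "B i \<subseteq> {1..m}" if "i \<in> {1..n}" for i using B(2)[OF that] by (auto simp: F_def)
  have sup: "B i \<subseteq> S i" for i by (auto simp: S_def)
  have Ssub: "S i \<subseteq> {1..m}" if "i \<in> {1..n}" for i using Bsub[OF that] by (auto simp: S_def)
  have "disjoint_family_on S {1..n}"
    unfolding disjoint_family_on_def
  proof (intro ballI impI)
    fix i j assume ij: "i \<in> {1..n}" "j \<in> {1..n}" "i \<noteq> j"
    hence "B i \<inter> B j = {}" using B(1) by (auto simp: disjoint_family_on_def)
    thus "S i \<inter> S j = {}" using ij by (auto simp: S_def)
  qed
  moreover have "(\<Union>i\<in>{1..n}. S i) = {1..m}"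
  proof
    show "(\<Union>i\<in>{1..n}. S i) \<subseteq> {1..m}" using Ssub by blast
    have "{1..m} \<subseteq> S 1 \<union> (\<Union>i\<in>{1..n}. B i)" by (auto simp: S_def)
    also have "\<dots> \<subseteq> (\<Union>i\<in>{1..n}. S i)" using sup n by fastforce
    finally show "{1..m} \<subseteq> (\<Union>i\<in>{1..n}. S i)" .
  qed
  ultimately have "allocation m n S" by (simp add: allocation_def)
  moreover have "\<tau> i \<le> v i (S i)" if i: "i \<in> {1..n}" for i
    using upclosedD[OF up[OF i] B(2)[OF i] sup Ssub[OF i]] by (simp add: F_def)
  ultimately show "\<exists>S. allocation m n S \<and> (\<forall>i\<in>{1..n}. quantile_share m n c q (v i) \<le> v i (S i))"
    unfolding \<tau>_def by blast
qed

text \<open>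
  With \<open>y = c / (n - c)\<close> one has \<open>1 - c / n = 1 / (1 + y) \<ge> exp (- y)\<close>, and \<open>(n - 1) y \<le> c\<close>
  because \<open>c \<le> 1\<close>.
\<close>

lemma exp_minus_le_power:
  fixes c :: real
  assumes "2 \<le> n" "0 < c" "c \<le> 1"
  shows "exp (- c) \<le> (1 - c / real n) ^ (n - 1)"
proof -
  have n: "real n \<ge> 2" using assms by simp
  define y where "y = c / (real n - c)"
  have pos: "0 < real n - c" using assms n by linarith
  have "1 + y \<le> exp y" by (rule exp_ge_add_one_self)
  moreover have "1 + y = inverse (1 - c / real n)" using pos n by (simp add: y_def field_simps)
  moreover have "0 < 1 - c / real n" using pos n by (simp add: field_simps)
  ultimately have "exp (- y) \<le> 1 - c / real n"
    using le_imp_inverse_le[of "inverse (1 - c / real n)" "exp y"] by (simp add: exp_minus)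
  hence "exp (- y) ^ (n - 1) \<le> (1 - c / real n) ^ (n - 1)" by (intro power_mono) auto
  moreover have "exp (- c) \<le> exp (- y) ^ (n - 1)"
  proof -
    have "real (n - 1) * y \<le> c"
    proof -
      have "(real n - 1) * c \<le> c * (real n - c)" using assms by (simp add: algebra_simps mult_le_cancel_left1)
      thus ?thesis using pos assms by (simp add: y_def field_simps of_nat_diff)
    qed
    thus ?thesis by (simp flip: exp_of_nat_mult)
  qed
  ultimately show ?thesis by linarith
qed

lemma exp_1_mult_le:
  fixes c :: real
  assumes "0 < c" "c \<le> 1 / 24"
  shows "exp 1 * c \<le> 1 / 3"
proof -
  have "exp 1 * c \<le> 3 * (1 / 24)" using exp_le assms by (intro mult_mono) auto
  thus ?thesis by simp
qed

lemma inverse_log_le: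
  fixes x :: real
  assumes "1 \<le> x"
  shows "1 / (12 * ln (exp 2 * x)) \<le> 1 / 24"
proof -
  have "ln (exp 2 * x) = 2 + ln x" using assms by (simp add: ln_mult)
  hence "24 \<le> 12 * ln (exp 2 * x)" using assms by simp
  thus ?thesis by (simp add: frac_le)
qed

theorem theorem4p2:
  shows "(\<forall>(n::nat) (c::real) (q::real).
            n \<ge> 2 \<longrightarrow> 0 < c \<longrightarrow> c < 1 / (12 * ln (exp 2 * real n)) \<longrightarrow>
            0 < q \<longrightarrow> q < 1 \<longrightarrow> q \<le> (1 - c / real n) ^ (n - 1) \<longrightarrow>
            share_feasible n c q)
       \<and> (\<forall>(n::nat) (c::real) (q::real).
            n \<ge> 10 ^ 7 + 2 \<longrightarrow> 0 < c \<longrightarrow> c < 1 / (3 * exp 1) \<longrightarrow>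
            0 < q \<longrightarrow> q < 1 \<longrightarrow> q \<le> (1 - c / real n) ^ (n - 1) \<longrightarrow>
            share_feasible n c q)
       \<and> (\<forall>(c::real) (q::real).
            0 < c \<longrightarrow> c < 1 / (12 * ln (exp 2 * (10 ^ 7 + 1))) \<longrightarrow>
            0 < q \<longrightarrow> q < 1 \<longrightarrow> q \<le> exp (- c) \<longrightarrow>
            universally_feasible c q)"
proof -
  have small: "share_feasible n c q"
    if "2 \<le> n" "0 < c" "c \<le> 1 / 24" "0 < q" "q \<le> (1 - c / real n) ^ (n - 1)" for n c q
  proof (rule share_feasible_core)
    have "c / real n \<le> (1 / 24) / 2" using that by (intro frac_le) auto
    thus "c / real n \<le> 1 / 48" by simp
    show "exp 1 * c \<le> 1 / 3" using that by (intro exp_1_mult_le) auto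
  qed (use that in auto)
  show ?thesis
  proof (intro conjI allI impI)
    fix n :: nat and c q :: real
    assume *: "2 \<le> n" "0 < c" "c < 1 / (12 * ln (exp 2 * real n))" "0 < q" "q < 1"
      "q \<le> (1 - c / real n) ^ (n - 1)"
    show "share_feasible n c q"
      using * inverse_log_le[of "real n"] by (intro small) auto
  next
    fix n :: nat and c q :: real
    assume *: "10 ^ 7 + 2 \<le> n" "0 < c" "c < 1 / (3 * exp 1)" "0 < q" "q < 1"
      "q \<le> (1 - c / real n) ^ (n - 1)"
    have c: "exp 1 * c \<le> 1 / 3" using *(3) by (simp add: field_simps)
    have "2 * c \<le> exp 1 * c" using exp_1_ge *(2) by (intro mult_right_mono) auto
    hence "c \<le> 1 / 6" using c by simp
    hence "c / real n \<le> (1 / 6) / 8" using * by (intro frac_le) auto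
    thus "share_feasible n c q" using * c by (intro share_feasible_core) auto
  next
    fix c q :: real
    assume *: "0 < c" "c < 1 / (12 * ln (exp 2 * (10 ^ 7 + 1)))" "0 < q" "q < 1" "q \<le> exp (- c)"
    have c: "c \<le> 1 / 24" using *(2) inverse_log_le[of "10 ^ 7 + 1"] by auto
    show "universally_feasible c q"
      unfolding universally_feasible_def
    proof (intro allI impI)
      fix n :: nat assume n: "2 \<le> n"
      show "share_feasible n c q"
        using n * c exp_minus_le_power[OF n *(1)] by (intro small) auto
    qed
  qed
qed

end
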